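(* Let $d=3$. There is exactly one local-unitary (LU) equivalence class of AME$(4,3)$ states; equivalently, there is exactly one LU-equivalence class of 2-unitary matrices of size $9$. That is, 2-unitary matrices $U\in\mathcal{U}(9)$ (acting on $\mathbb{C}^3\otimes\mathbb{C}^3$) exist, and for any two 2-unitary matrices $U,U'\in\mathcal{U}(9)$ there exist $3\times 3$ unitaries $u_1,u_2,v_1,v_2$ with $U'=(u_1\otimes u_2)\,U\,(v_1\otimes v_2)$; likewise AME$(4,3)$ states exist, and any two AME$(4,3)$ states $|\psi_1\rangle,|\psi_2\rangle$ satisfy $|\psi_2\rangle=(w_1\otimes w_2\otimes w_3\otimes w_4)|\psi_1\rangle$ for some $3\times 3$ unitaries $w_1,\dots,w_4$.
   Context: An AME$(4,d)$ (absolutely maximally entangled) state is a pure state $|\psi\rangle\in(\mathbb{C}^d)^{\otimes 4}$ such that the reduced density matrix of every subset of at most two of the four parties is maximally mixed. Two four-party states are LU-equivalent if one is obtained from the other by applying a tensor product $w_1\otimes w_2\otimes w_3\otimes w_4$ of single-qudit unitaries. For a matrix $U$ on $\mathbb{C}^d\otimes\mathbb{C}^d$ with entries $\langle i\alpha|U|j\beta\rangle$ in the computational product basis, its realignment $U^R$ is defined by $\langle ij|U^R|\alpha\beta\rangle=\langle i\alpha|U|j\beta\rangle$ and its partial transpose $U^\Gamma$ by $\langle i\beta|U^\Gamma|j\alpha\rangle=\langle i\alpha|U|j\beta\rangle$. $U$ is 2-unitary if $U$, $U^R$ and $U^\Gamma$ are all unitary. Two matrices $U,U'$ of size $d^2$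 are LU-equivalent if $U'=(u_1\otimes u_2)U(v_1\otimes v_2)$ for some $d\times d$ unitaries $u_1,u_2,v_1,v_2$. A unitary $U$ of size $d^2$ defines the four-party state $|\Psi_U\rangle=\frac1d\sum_{i,\alpha,j,\beta}\langle i\alpha|U|j\beta\rangle\,|i\alpha j\beta\rangle$, which is AME$(4,d)$ when $U$ is 2-unitary. *)

theory Defs
  imports Complex_Main "HOL-Library.FuncSet"
begin

definition unitary_mat :: "nat \<Rightarrow> (nat \<Rightarrow> nat \<Rightarrow> complex) \<Rightarrow> bool" where
  "unitary_mat d u \<longleftrightarrow>
     (\<forall>i<d. \<forall>j<d. (\<Sum>k<d. cnj (u k i) * u k j) = (if i = j then 1 else 0)) \<and>
     (\<forall>i<d. \<forall>j<d. (\<Sum>k<d. u i k * cnj (u j k)) = (if i = j then 1 else 0))"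

text \<open>A matrix of size d^2 on C^d (x) C^d, given by its entries
  U i a j b = <i a|U|j b> in the computational product basis (all indices < d).\<close>

type_synonym op2 = "nat \<Rightarrow> nat \<Rightarrow> nat \<Rightarrow> nat \<Rightarrow> complex"

definition unitary_op2 :: "nat \<Rightarrow> op2 \<Rightarrow> bool" where
  "unitary_op2 d U \<longleftrightarrow>
     (\<forall>i<d. \<forall>a<d. \<forall>j<d. \<forall>b<d.
        (\<Sum>k<d. \<Sum>c<d. cnj (U k c i a) * U k c j b) = (if i = j \<and> a = b then 1 else 0)) \<and>
     (\<forall>i<d. \<forall>a<d. \<forall>j<d. \<forall>b<d.
        (\<Sum>k<d. \<Sum>c<d. U i a k c * cnj (U j b k c)) = (if i = j \<and> a = b then 1 else 0))"

definition realign :: "op2 \<Rightarrow> op2" where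
  "realign U = (\<lambda>i j a b. U i a j b)"

definition ptrans :: "op2 \<Rightarrow> op2" where
  "ptrans U = (\<lambda>i b j a. U i a j b)"

definition two_unitary :: "nat \<Rightarrow> op2 \<Rightarrow> bool" where
  "two_unitary d U \<longleftrightarrow> unitary_op2 d U \<and> unitary_op2 d (realign U) \<and> unitary_op2 d (ptrans U)"

definition LU_equiv_op2 :: "nat \<Rightarrow> op2 \<Rightarrow> op2 \<Rightarrow> bool" where
  "LU_equiv_op2 d U U' \<longleftrightarrow>
     (\<exists>u1 u2 v1 v2. unitary_mat d u1 \<and> unitary_mat d u2 \<and> unitary_mat d v1 \<and> unitary_mat d v2 \<and>
        (\<forall>i<d. \<forall>a<d. \<forall>j<d. \<forall>b<d.
           U' i a j b = (\<Sum>k<d. \<Sum>c<d. \<Sum>l<d. \<Sum>e<d.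
              u1 i k * u2 a c * U k c l e * v1 l j * v2 e b)))"

text \<open>Four-party states: a state is a coefficient function on basis configurations,
  a configuration being an assignment of a level < d to each of the parties 0,1,2,3.\<close>

definition cfgs :: "nat \<Rightarrow> nat set \<Rightarrow> (nat \<Rightarrow> nat) set" where
  "cfgs d S = S \<rightarrow>\<^sub>E {..<d}"

type_synonym state4 = "(nat \<Rightarrow> nat) \<Rightarrow> complex"

definition parties :: "nat set" where "parties = {0..<4}"

definition pure_state4 :: "nat \<Rightarrow> state4 \<Rightarrow> bool" where
  "pure_state4 d \<psi> \<longleftrightarrow> (\<Sum>f\<in>cfgs d parties. (cmod (\<psi> f))\<^sup>2) = 1"

definition reduced :: "nat \<Rightarrow> state4 \<Rightarrow> nat set \<Rightarrow> (nat \<Rightarrow> nat) \<Rightarrow> (nat \<Rightarrow> nat) \<Rightarrow> complex" where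
  "reduced d \<psi> S x y =
     (\<Sum>z\<in>cfgs d (parties - S).
        \<psi> (\<lambda>p. if p \<in> S then x p else z p) * cnj (\<psi> (\<lambda>p. if p \<in> S then y p else z p)))"

definition maximally_mixed_on :: "nat \<Rightarrow> state4 \<Rightarrow> nat set \<Rightarrow> bool" where
  "maximally_mixed_on d \<psi> S \<longleftrightarrow>
     (\<forall>x\<in>cfgs d S. \<forall>y\<in>cfgs d S.
        reduced d \<psi> S x y = (if x = y then 1 / of_nat (d ^ card S) else 0))"

definition AME4 :: "nat \<Rightarrow> state4 \<Rightarrow> bool" where
  "AME4 d \<psi> \<longleftrightarrow> pure_state4 d \<psi> \<and>
     (\<forall>S. S \<subseteq> parties \<and> card S \<le> 2 \<longrightarrow> maximally_mixed_on d \<psi> S)"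

definition LU_equiv_state4 :: "nat \<Rightarrow> state4 \<Rightarrow> state4 \<Rightarrow> bool" where
  "LU_equiv_state4 d \<psi>1 \<psi>2 \<longleftrightarrow>
     (\<exists>w :: nat \<Rightarrow> nat \<Rightarrow> nat \<Rightarrow> complex. (\<forall>p\<in>parties. unitary_mat d (w p)) \<and>
        (\<forall>f\<in>cfgs d parties.
           \<psi>2 f = (\<Sum>g\<in>cfgs d parties. (\<Prod>p\<in>parties. w p (f p) (g p)) * \<psi>1 g)))"

end

theory Submission
  imports Defs "HOL-Library.Function_Algebras" "HOL-Analysis.Continuum_Not_Denumerable"
    "HOL-Computational_Algebra.Fundamental_Theorem_Algebra"
begin

text \<open>
  A 2-unitary \<open>T\<close> maps some product vector to a product vector: the two copies of the Segre fourfold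
  \<open>P\<^sup>2 \<times> P\<^sup>2\<close> involved meet in \<open>P\<^sup>8\<close> for dimension reasons. After a rotation \<open>T 0 0 0 0 = 1\<close>, and
  unitarity of the three rearrangements kills every other entry agreeing with \<open>0000\<close> in two places.
  What is left of the slice \<open>T 0\<close> is a \<open>2 \<times> 2 \<times> 2\<close> tensor, which a root of a quadratic turns into a
  GHZ state, so that \<open>T 0 j j j\<close> are its only nonzero entries. By the pigeonhole principle the other
  slices then live on permutations of \<open>012\<close>, and a rotation separates the even from the odd ones.
  Now \<open>T\<close> is supported on the nine words of the tetracode with entries of modulus one, and diagonal
  unitaries remove the phases.

  The intersection point is found in the graded ring generated by the eighteen products
  \<open>a i * b j\<close> and \<open>c k * d l\<close>. If the nine linear forms expressing \<open>T (a \<otimes> b) = c \<otimes> d\<close> had no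
  common zero, then by a Nullstellensatz every generator would be nilpotent modulo them, so the
  component of degree \<open>s\<close> would have dimension \<open>O(s ^ 8)\<close>, whereas it grows like \<open>s ^ 9\<close>.
\<close>

subsection \<open>Graded rings of functions\<close>

declare plus_fun_apply [simp del] zero_fun_apply [simp del] times_fun_apply [simp del]
  one_fun_apply [simp del] minus_apply [simp del] uminus_apply [simp del]

text \<open>Functions stand in for polynomials: the ring structure is the pointwise one, so
  relations such as the vanishing of minors hold by evaluation. \<open>scl\<close> supplies the
  complex vector space structure.\<close>

definition scl :: "complex \<Rightarrow> ('x \<Rightarrow> complex) \<Rightarrow> 'x \<Rightarrow> complex" where
  "scl c f = (\<lambda>x. c * f x)"

interpretation fv: vector_space scl
  by unfold_locales (auto simp: scl_def fun_eq_iff plus_fun_apply algebra_simps)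

lemma scl_apply: "scl c f v = c * f v"
  by (simp add: scl_def)

lemma sum_fun_apply: "sum f A v = (\<Sum>i\<in>A. f i v)" for f :: "'i \<Rightarrow> 'x \<Rightarrow> complex"
  by (induction A rule: infinite_finite_induct)
    (auto simp: zero_fun_apply one_fun_apply plus_fun_apply times_fun_apply)

lemma prod_fun_apply: "prod f A v = (\<Prod>i\<in>A. f i v)" for f :: "'i \<Rightarrow> 'x \<Rightarrow> complex"
  by (induction A rule: infinite_finite_induct)
    (auto simp: zero_fun_apply one_fun_apply plus_fun_apply times_fun_apply)

lemma prod_mset_fun_apply: "(\<Prod>i\<in>#A. f i) v = (\<Prod>i\<in>#A. f i v)" for f :: "'i \<Rightarrow> 'x \<Rightarrow> complex"
  by (induction A) (auto simp: one_fun_apply times_fun_apply)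

lemma power_fun_apply: "(f ^ n) v = f v ^ n" for f :: "'x \<Rightarrow> complex"
  by (induction n) (auto simp: one_fun_apply times_fun_apply)

lemmas pointwise = fun_eq_iff plus_fun_apply zero_fun_apply times_fun_apply one_fun_apply
  minus_apply uminus_apply scl_apply power_fun_apply sum_fun_apply prod_fun_apply prod_mset_fun_apply

lemma span_times:
  assumes AB: "\<And>a b. a \<in> A \<Longrightarrow> b \<in> B \<Longrightarrow> a * b \<in> fv.span C"
    and u: "u \<in> fv.span A" and v: "v \<in> fv.span B"
  shows "u * v \<in> fv.span C"
  using u
proof (induction rule: fv.span_induct_alt)
  case base
  then show ?case by (simp add: fv.span_zero)
next
  case (step c a y)
  have "a * v \<in> fv.span C"
    using v
  proof (induction rule: fv.span_induct_alt)
    case base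
    then show ?case by (simp add: fv.span_zero)
  next
    case (step d b w)
    have "a * (scl d b + w) = scl d (a * b) + a * w"
      by (simp add: pointwise algebra_simps)
    then show ?case
      using AB[OF \<open>a \<in> A\<close> step(1)] step(2) by (simp add: fv.span_add fv.span_scale)
  qed
  moreover have "(scl c a + y) * v = scl c (a * v) + y * v"
    by (simp add: pointwise algebra_simps)
  ultimately show ?case
    using step by (simp add: fv.span_add fv.span_scale)
qed

text \<open>Stated for an indexed family, since its members may coincide: a repetition is itself a
  relation, with coefficients \<open>1\<close> and \<open>-1\<close>; otherwise the dimension bound
  applies to the image.\<close>

lemma dependent_family:
  assumes "finite I" "finite B" "card B < card I" and y: "\<And>i. i \<in> I \<Longrightarrow> y i \<in> fv.span B"
  shows "\<exists>c. (\<exists>i\<in>I. c i \<noteq> 0) \<and> (\<Sum>i\<in>I. scl (c i) (y i)) = 0"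
proof (cases "inj_on y I")
  case True
  have "fv.dependent (y ` I)"
    using True fv.independent_span_bound[OF assms(2), of "y ` I"] assms by (auto simp: card_image)
  then obtain u where u: "\<exists>v\<in>y ` I. u v \<noteq> 0" "(\<Sum>v\<in>y ` I. scl (u v) v) = 0"
    unfolding fv.dependent_finite[OF finite_imageI[OF assms(1)]] by blast
  then show ?thesis
    using True by (intro exI[of _ "u \<circ> y"]) (auto simp: sum.reindex)
next
  case False
  then obtain i j where ij: "i \<in> I" "j \<in> I" "i \<noteq> j" "y i = y j"
    by (auto simp: inj_on_def)
  let ?c = "\<lambda>k. if k = i then 1 else if k = j then -1 else (0::complex)"
  have "(\<Sum>k\<in>I. scl (?c k) (y k)) = (\<Sum>k\<in>{i,j}. scl (?c k) (y k))"
    using ij assms(1) by (intro sum.mono_neutral_right) (auto simp: pointwise)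
  also have "\<dots> = 0"
    using ij(3,4) by (simp add: pointwise)
  finally show ?thesis
    using ij by (intro exI[of _ ?c]) auto
qed

section \<open>Homogeneous components of the ring and of an ideal\<close>

primrec prods :: "('x \<Rightarrow> complex) set \<Rightarrow> nat \<Rightarrow> ('x \<Rightarrow> complex) set" where
  "prods G 0 = {1}"
| "prods G (Suc t) = (\<lambda>(g, m). g * m) ` (G \<times> prods G t)"

definition forms :: "('x \<Rightarrow> complex) set \<Rightarrow> nat \<Rightarrow> ('x \<Rightarrow> complex) set" where
  "forms G t = fv.span (prods G t)"

text \<open>The degree \<open>t\<close> part of the ideal generated by \<open>L\<close>, whose
  members count as having degree one; it is zero for \<open>t = 0\<close>. The degree is an explicit
  argument because a function by itself does not determine one.\<close>

definition ideal_part :: "('x \<Rightarrow> complex) set \<Rightarrow> ('x \<Rightarrow> complex) set \<Rightarrow> nat \<Rightarrow> ('x \<Rightarrow> complex) set" where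
  "ideal_part G L t = fv.span {l * r | l r s. l \<in> L \<and> r \<in> forms G s \<and> t = Suc s}"

lemma finite_prods: "finite G \<Longrightarrow> finite (prods G t)"
  by (induction t) auto

lemma prods_mult: "a \<in> prods G s \<Longrightarrow> b \<in> prods G t \<Longrightarrow> a * b \<in> prods G (s + t)"
  by (induction s arbitrary: a) (force simp: mult.assoc)+

lemma forms_mult: "u \<in> forms G s \<Longrightarrow> v \<in> forms G t \<Longrightarrow> u * v \<in> forms G (s + t)"
  unfolding forms_def by (rule span_times) (auto intro: fv.span_base prods_mult)

lemma one_in_forms: "1 \<in> forms G 0"
  by (simp add: forms_def fv.span_base)

lemma generator_in_forms: "x \<in> G \<Longrightarrow> x \<in> forms G 1"
  by (force simp: forms_def intro: fv.span_base)

lemma power_in_forms: "x \<in> forms G 1 \<Longrightarrow> x ^ t \<in> forms G t"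
proof (induction t)
  case (Suc t)
  then show ?case using forms_mult[of x G 1 "x ^ t" t] by simp
qed (simp add: one_in_forms)

lemma prod_in_forms:
  "(\<And>i. i \<in> I \<Longrightarrow> f i \<in> forms G 1) \<Longrightarrow> finite I \<Longrightarrow> prod f I \<in> forms G (card I)"
  by (induction I rule: infinite_finite_induct)
    (use forms_mult[of _ G 1] in \<open>auto simp: one_in_forms\<close>)

lemma prod_mset_in_forms:
  "(\<And>i. f i \<in> forms G 1) \<Longrightarrow> (\<Prod>i\<in>#I. f i) \<in> forms G (size I)"
  by (induction I) (use forms_mult[of _ G 1] in \<open>auto simp: one_in_forms\<close>)

lemma ideal_part_mult:
  assumes "u \<in> ideal_part G L t" "v \<in> forms G s"
  shows "u * v \<in> ideal_part G L (t + s)"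
  using assms(1) unfolding ideal_part_def
proof (rule span_times[rotated])
  show "v \<in> fv.span (forms G s)"
    using assms by (simp add: fv.span_base)
  fix a b
  assume "a \<in> {l * r |l r s. l \<in> L \<and> r \<in> forms G s \<and> t = Suc s}" "b \<in> forms G s"
  then obtain l r s' where "a = l * r" "l \<in> L" "r \<in> forms G s'" "t = Suc s'"
    by blast
  then show "a * b \<in> fv.span {l * r |l r s'. l \<in> L \<and> r \<in> forms G s' \<and> t + s = Suc s'}"
    using \<open>b \<in> forms G s\<close>
    by (intro fv.span_base CollectI exI[of _ l] exI[of _ "r * b"] exI[of _ "s' + s"])
      (auto simp: mult.assoc forms_mult)
qed

lemma ideal_part_add: "u \<in> ideal_part G L t \<Longrightarrow> v \<in> ideal_part G L t \<Longrightarrow> u + v \<in> ideal_part G L t"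
  and ideal_part_diff: "u \<in> ideal_part G L t \<Longrightarrow> v \<in> ideal_part G L t \<Longrightarrow> u - v \<in> ideal_part G L t"
  and ideal_part_scl: "u \<in> ideal_part G L t \<Longrightarrow> scl c u \<in> ideal_part G L t"
  and ideal_part_sum: "(\<And>i. i \<in> I \<Longrightarrow> h i \<in> ideal_part G L t) \<Longrightarrow> sum h I \<in> ideal_part G L t"
  unfolding ideal_part_def by (auto intro: fv.span_add fv.span_diff fv.span_scale fv.span_sum)

lemma ideal_part_0: "ideal_part G L 0 = {0}"
  by (simp add: ideal_part_def)

lemma ideal_part_base: "l \<in> L \<Longrightarrow> l \<in> ideal_part G L 1"
  unfolding ideal_part_def
  by (intro fv.span_base CollectI exI[of _ l] exI[of _ 1] exI[of _ 0]) (auto simp: one_in_forms)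

text \<open>All terms have the same degree, so the cofactors of \<open>l\<close> can be collected
  into one form of degree \<open>s\<close>; the other terms stay in the old ideal.\<close>

lemma ideal_part_insert:
  assumes "u \<in> ideal_part G (insert l L) (Suc s)"
  shows "\<exists>y\<in>forms G s. u - l * y \<in> ideal_part G L (Suc s)"
  using assms unfolding ideal_part_def
proof (induction rule: fv.span_induct_alt)
  case base
  then show ?case by (intro bexI[of _ 0]) (auto simp: forms_def fv.span_zero)
next
  case (step c a w)
  then obtain y where y: "y \<in> forms G s"
    "w - l * y \<in> fv.span {l * r |l r s'. l \<in> L \<and> r \<in> forms G s' \<and> Suc s = Suc s'}" by blast
  from step obtain l' r where a: "a = l' * r" "l' \<in> insert l L" "r \<in> forms G s"
    by blast
  show ?case
  proof (cases "l' = l")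
    case True
    have "scl c a + w - l * (y + scl c r) = w - l * y"
      by (simp add: a True pointwise algebra_simps)
    then show ?thesis
      using y a(3) by (intro bexI[of _ "y + scl c r"])
        (simp only:, auto simp: forms_def intro: fv.span_add fv.span_scale)
  next
    case False
    have "scl c a \<in> fv.span {l * r |l r s'. l \<in> L \<and> r \<in> forms G s' \<and> Suc s = Suc s'}"
      using a False by (intro fv.span_scale fv.span_base) auto
    then show ?thesis
      using y by (intro bexI[of _ y]) (auto simp: add_diff_eq[symmetric] intro: fv.span_add)
  qed
qed

subsection \<open>A graded Nullstellensatz\<close>

text \<open>Amitsur's trick: the ring has countable dimension, so the uncountably many would-be inverses
  of \<open>z - \<mu> x\<close> are linearly dependent.\<close>

lemma ideal_part_extend:
  fixes G :: "('x \<Rightarrow> complex) set"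
  assumes G: "finite G" "x \<in> G" "z \<in> G" and good: "\<And>t. x ^ t \<notin> ideal_part G L t"
  shows "\<exists>\<mu>. \<forall>t. x ^ t \<notin> ideal_part G (insert (z - scl \<mu> x) L) t"
proof (rule ccontr)
  define lin where "lin = (\<lambda>\<mu>. z - scl \<mu> x)"
  assume "\<nexists>\<mu>. \<forall>t. x ^ t \<notin> ideal_part G (insert (z - scl \<mu> x) L) t"
  then have "\<forall>\<mu>. \<exists>t. x ^ t \<in> ideal_part G (insert (lin \<mu>) L) t"
    by (auto simp: lin_def)
  moreover have "x ^ 0 \<notin> ideal_part G M 0" for M
    by (simp add: ideal_part_0)
  ultimately have "\<forall>\<mu>. \<exists>s. x ^ Suc s \<in> ideal_part G (insert (lin \<mu>) L) (Suc s)"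
    by (metis not0_implies_Suc)
  then have "\<forall>\<mu>. \<exists>s y. y \<in> forms G s \<and> x ^ Suc s - lin \<mu> * y \<in> ideal_part G L (Suc s)"
    using ideal_part_insert by blast
  \<comment> \<open>Modulo the ideal, \<open>y \<mu>\<close> is an inverse of
    \<open>lin \<mu>\<close> up to a power of \<open>x\<close>.\<close>
  then obtain s y where sy: "\<And>\<mu>. y \<mu> \<in> forms G (s \<mu>)"
    "\<And>\<mu>. x ^ Suc (s \<mu>) - lin \<mu> * y \<mu> \<in> ideal_part G L (Suc (s \<mu>))"
    by metis
  have x1: "x \<in> forms G 1" and z1: "z \<in> forms G 1"
    using G generator_in_forms by blast+
  have lin1: "lin \<mu> \<in> forms G 1" for \<mu>
    using x1 z1 unfolding lin_def forms_def by (intro fv.span_diff fv.span_scale)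

  \<comment> \<open>Multiplication by \<open>y \<mu>\<close> trades a factor
    \<open>lin \<mu>\<close> for a power of \<open>x\<close>, so the linear factors can be removed
    one by one until a pure power of \<open>x\<close> lies in the ideal.\<close>
  have kill: "\<exists>m. x ^ m \<in> ideal_part G L m"
    if "x ^ n * (\<Prod>\<mu>\<in>#A. lin \<mu>) \<in> ideal_part G L (n + size A)" for n A
    using that
  proof (induction A arbitrary: n)
    case empty
    then show ?case by auto
  next
    case (add \<mu> A)
    let ?P = "\<Prod>\<mu>\<in>#A. lin \<mu>"
    have "(x ^ n * (lin \<mu> * ?P)) * y \<mu> \<in> ideal_part G L (n + Suc (size A) + s \<mu>)"
      using ideal_part_mult[OF add.prems sy(1)[of \<mu>]] by simp
    moreover have "(x ^ Suc (s \<mu>) - lin \<mu> * y \<mu>) * (x ^ n * ?P)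
        \<in> ideal_part G L (Suc (s \<mu>) + (n + size A))"
      using sy(2) by (intro ideal_part_mult forms_mult power_in_forms x1 prod_mset_in_forms lin1)
    ultimately have "(x ^ n * (lin \<mu> * ?P)) * y \<mu> + (x ^ Suc (s \<mu>) - lin \<mu> * y \<mu>) * (x ^ n * ?P)
        \<in> ideal_part G L (Suc (s \<mu>) + n + size A)"
      by (intro ideal_part_add) (auto simp: ac_simps)
    also have "(x ^ n * (lin \<mu> * ?P)) * y \<mu> + (x ^ Suc (s \<mu>) - lin \<mu> * y \<mu>) * (x ^ n * ?P)
        = x ^ (Suc (s \<mu>) + n) * ?P"
      by (simp add: algebra_simps power_add)
    finally show ?case by (rule add.IH)
  qed

  \<comment> \<open>There are countably many degrees but uncountably many \<open>\<mu>\<close>, so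
    infinitely many \<open>y \<mu>\<close> lie in one component, which has finite dimension.\<close>
  have "\<exists>s0. infinite (s -` {s0})"
  proof (rule ccontr)
    assume "\<not> ?thesis"
    then have "countable (\<Union>n. s -` {n})"
      by (intro countable_UN) (auto intro: countable_finite)
    moreover have "(\<Union>n. s -` {n}) = UNIV" by auto
    ultimately show False using uncountable_UNIV_complex by simp
  qed
  then obtain s0 where "infinite (s -` {s0})" by blast
  then obtain \<Lambda> where \<Lambda>: "finite \<Lambda>" "card \<Lambda> = Suc (card (prods G s0))" "\<Lambda> \<subseteq> s -` {s0}"
    using infinite_arbitrarily_large by blast
  define K where "K = card (prods G s0)"
  have "y \<mu> \<in> fv.span (prods G s0)" if "\<mu> \<in> \<Lambda>" for \<mu>
    using sy(1)[of \<mu>] \<Lambda>(3) that by (auto simp: forms_def)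
  then obtain c where c: "\<exists>\<mu>\<in>\<Lambda>. c \<mu> \<noteq> 0" "(\<Sum>\<mu>\<in>\<Lambda>. scl (c \<mu>) (y \<mu>)) = 0"
    using dependent_family[OF \<Lambda>(1) finite_prods[OF G(1)], of s0 y] \<Lambda>(2) by auto
  \<comment> \<open>The numerator of the sum of the \<open>c \<mu> / lin \<mu>\<close> over a common
    denominator. Up to a power of \<open>x\<close> that sum is congruent to the vanishing
    combination of the \<open>y \<mu>\<close>.\<close>
  define P where "P = (\<Sum>\<mu>\<in>\<Lambda>. scl (c \<mu>) (\<Prod>\<nu>\<in>\<Lambda>-{\<mu>}. lin \<nu>))"
  have P: "P * x ^ Suc s0 \<in> ideal_part G L (Suc s0 + K)"
  proof -
    have lin_prod: "(\<Prod>\<nu>\<in>\<Lambda>-{\<mu>}. lin \<nu>) \<in> forms G K" if "\<mu> \<in> \<Lambda>" for \<mu>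
      using prod_in_forms[of "\<Lambda>-{\<mu>}" lin G] lin1 \<Lambda> that by (simp add: K_def)
    have "(\<Sum>\<mu>\<in>\<Lambda>. (x ^ Suc s0 - lin \<mu> * y \<mu>) * scl (c \<mu>) (\<Prod>\<nu>\<in>\<Lambda>-{\<mu>}. lin \<nu>)) \<in> ideal_part G L (Suc s0 + K)"
    proof (intro ideal_part_sum ideal_part_mult)
      fix \<mu> assume "\<mu> \<in> \<Lambda>"
      then show "x ^ Suc s0 - lin \<mu> * y \<mu> \<in> ideal_part G L (Suc s0)"
        using sy(2)[of \<mu>] \<Lambda>(3) by auto
      show "scl (c \<mu>) (\<Prod>\<nu>\<in>\<Lambda>-{\<mu>}. lin \<nu>) \<in> forms G K"
        using lin_prod[OF \<open>\<mu> \<in> \<Lambda>\<close>] unfolding forms_def by (rule fv.span_scale)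
    qed
    also have "(\<Sum>\<mu>\<in>\<Lambda>. (x ^ Suc s0 - lin \<mu> * y \<mu>) * scl (c \<mu>) (\<Prod>\<nu>\<in>\<Lambda>-{\<mu>}. lin \<nu>))
      = (\<Sum>\<mu>\<in>\<Lambda>. scl (c \<mu>) (\<Prod>\<nu>\<in>\<Lambda>-{\<mu>}. lin \<nu>) * x ^ Suc s0)
       - (\<Sum>\<mu>\<in>\<Lambda>. (\<Prod>\<nu>\<in>\<Lambda>. lin \<nu>) * scl (c \<mu>) (y \<mu>))"
      unfolding sum_subtractf[symmetric]
    proof (rule sum.cong)
      fix \<mu> assume "\<mu> \<in> \<Lambda>"
      then have "(\<Prod>\<nu>\<in>\<Lambda>. lin \<nu>) = lin \<mu> * (\<Prod>\<nu>\<in>\<Lambda>-{\<mu>}. lin \<nu>)"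
        using \<Lambda>(1) by (rule prod.remove[rotated])
      then show "(x ^ Suc s0 - lin \<mu> * y \<mu>) * scl (c \<mu>) (\<Prod>\<nu>\<in>\<Lambda>-{\<mu>}. lin \<nu>)
        = scl (c \<mu>) (\<Prod>\<nu>\<in>\<Lambda>-{\<mu>}. lin \<nu>) * x ^ Suc s0 - (\<Prod>\<nu>\<in>\<Lambda>. lin \<nu>) * scl (c \<mu>) (y \<mu>)"
        by (simp add: pointwise algebra_simps)
    qed auto
    also have "(\<Sum>\<mu>\<in>\<Lambda>. (\<Prod>\<nu>\<in>\<Lambda>. lin \<nu>) * scl (c \<mu>) (y \<mu>)) = 0"
      by (simp add: sum_distrib_left[symmetric] c(2))
    finally show ?thesis
      by (simp add: P_def sum_distrib_right)
  qed

  \<comment> \<open>\<open>P\<close> is the homogenisation of \<open>p\<close> to degree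
    \<open>K\<close> in \<open>z\<close> and \<open>x\<close>. At \<open>\<mu>0\<close> only the
    summand of \<open>\<mu>0\<close> survives, so \<open>p\<close> is nonzero, and over the complex
    numbers it splits into linear factors.\<close>
  define p where "p = (\<Sum>\<mu>\<in>\<Lambda>. smult (c \<mu>) (\<Prod>\<nu>\<in>\<Lambda>-{\<mu>}. [:-\<nu>, 1:]))"
  obtain \<mu>0 where \<mu>0: "\<mu>0 \<in> \<Lambda>" "c \<mu>0 \<noteq> 0" using c by blast
  have "poly p \<mu>0 = (\<Sum>\<mu>\<in>\<Lambda>. c \<mu> * (\<Prod>\<nu>\<in>\<Lambda>-{\<mu>}. \<mu>0 - \<nu>))"
    by (simp add: p_def poly_sum poly_prod)
  also have "\<dots> = (\<Sum>\<mu>\<in>{\<mu>0}. c \<mu> * (\<Prod>\<nu>\<in>\<Lambda>-{\<mu>}. \<mu>0 - \<nu>))"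
    using \<Lambda>(1) \<mu>0 by (intro sum.mono_neutral_right) (auto simp: prod_zero_iff)
  also have "\<dots> \<noteq> 0"
    using \<Lambda>(1) \<mu>0 by (auto simp: prod_zero_iff)
  finally have "p \<noteq> 0" by auto
  then obtain A where A: "size A = degree p" "p = smult (lead_coeff p) (\<Prod>\<mu>\<in>#A. [:-\<mu>, 1:])"
    using alg_closed_imp_factorization by blast
  have "degree p \<le> K"
    unfolding p_def
  proof (rule degree_sum_le[OF \<Lambda>(1)])
    fix \<mu> assume "\<mu> \<in> \<Lambda>"
    have "degree (smult (c \<mu>) (\<Prod>\<nu>\<in>\<Lambda>-{\<mu>}. [:-\<nu>, 1:])) \<le> degree (\<Prod>\<nu>\<in>\<Lambda>-{\<mu>}. [:-\<nu>, 1:])"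
      by (rule degree_smult_le)
    also have "\<dots> \<le> (\<Sum>\<nu>\<in>\<Lambda>-{\<mu>}. degree [:-\<nu>, 1:])"
      using degree_prod_sum_le[of "\<Lambda>-{\<mu>}" "\<lambda>\<nu>. [:-\<nu>, 1:]"] \<Lambda>(1) by (simp add: o_def)
    also have "\<dots> = K" using \<open>\<mu> \<in> \<Lambda>\<close> \<Lambda> by (simp add: K_def)
    finally show "degree (smult (c \<mu>) (\<Prod>\<nu>\<in>\<Lambda>-{\<mu>}. [:-\<nu>, 1:])) \<le> K" .
  qed
  \<comment> \<open>The factor \<open>x\<close> makes this pointwise identity true also where \<open>x\<close> vanishes.\<close>
  have key: "P * x = scl (lead_coeff p) (x ^ Suc (K - size A) * (\<Prod>\<mu>\<in>#A. lin \<mu>))"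
  proof
    fix v
    show "(P * x) v = scl (lead_coeff p) (x ^ Suc (K - size A) * (\<Prod>\<mu>\<in>#A. lin \<mu>)) v"
    proof (cases "x v = 0")
      case False
      define r where "r = z v / x v"
      have lin_v: "lin \<mu> v = x v * (r - \<mu>)" for \<mu>
        using False by (simp add: lin_def r_def pointwise algebra_simps)
      have "P v = (\<Sum>\<mu>\<in>\<Lambda>. c \<mu> * (x v ^ K * (\<Prod>\<nu>\<in>\<Lambda>-{\<mu>}. r - \<nu>)))"
        unfolding P_def sum_fun_apply scl_apply prod_fun_apply lin_v
        using \<Lambda> by (intro sum.cong) (auto simp: prod.distrib K_def)
      also have "\<dots> = x v ^ K * poly p r"
        by (simp add: p_def poly_sum poly_prod sum_distrib_left mult.left_commute)
      finally have 1: "P v = x v ^ K * poly p r" .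
      have "poly p r = lead_coeff p * (\<Prod>\<mu>\<in>#A. r - \<mu>)"
        by (subst A(2)) (simp add: poly_prod_mset)
      moreover have "(\<Prod>\<mu>\<in>#A. lin \<mu> v) = x v ^ size A * (\<Prod>\<mu>\<in>#A. r - \<mu>)"
        unfolding lin_v by (induction A) auto
      moreover have "x v ^ K = x v ^ (K - size A) * x v ^ size A"
        using A(1) \<open>degree p \<le> K\<close> by (simp add: power_add[symmetric])
      ultimately show ?thesis
        using 1 by (simp add: pointwise)
    qed (simp add: pointwise)
  qed
  have "(P * x ^ Suc s0) * x \<in> ideal_part G L (Suc s0 + K + 1)"
    by (rule ideal_part_mult[OF P x1])
  also have "(P * x ^ Suc s0) * x = scl (lead_coeff p) (x ^ Suc (K - size A) * (\<Prod>\<mu>\<in>#A. lin \<mu>)) * x ^ Suc s0"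
    unfolding key[symmetric] by (simp only: ac_simps)
  finally have "scl (1 / lead_coeff p) (scl (lead_coeff p) (x ^ Suc (K - size A) * (\<Prod>\<mu>\<in>#A. lin \<mu>)) * x ^ Suc s0)
      \<in> ideal_part G L (Suc s0 + K + 1)"
    by (rule ideal_part_scl)
  also have "scl (1 / lead_coeff p) (scl (lead_coeff p) (x ^ Suc (K - size A) * (\<Prod>\<mu>\<in>#A. lin \<mu>)) * x ^ Suc s0)
     = x ^ (Suc s0 + Suc (K - size A)) * (\<Prod>\<mu>\<in>#A. lin \<mu>)"
    using \<open>p \<noteq> 0\<close> by (simp add: pointwise power_add)
  also have "Suc s0 + K + 1 = Suc s0 + Suc (K - size A) + size A"
    using A(1) \<open>degree p \<le> K\<close> by simp
  finally show False
    using kill good by blast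
qed

text \<open>Adjoining \<open>z - scl (\<mu> z) x\<close> for one generator \<open>z\<close> after
  another keeps all powers of \<open>x\<close> outside the ideal. Modulo the final ideal every
  generator is a multiple of \<open>x\<close>, and the multiples are the coordinates of a common
  zero.\<close>

lemma ideal_part_common_zero:
  fixes g :: "'i \<Rightarrow> 'x \<Rightarrow> complex" and I :: "'i set"
  defines "G \<equiv> g ` I"
  assumes I: "finite I" and x: "x \<in> G" and good: "\<And>t. x ^ t \<notin> ideal_part G L t"
  shows "\<exists>\<mu>. (\<exists>i\<in>I. \<mu> i \<noteq> 0) \<and>
    (\<forall>c. (\<Sum>i\<in>I. scl (c i) (g i)) \<in> L \<longrightarrow> (\<Sum>i\<in>I. c i * \<mu> i) = 0) \<and>
    (\<forall>p\<in>I. \<forall>q\<in>I. \<forall>r\<in>I. \<forall>s\<in>I. g p * g q = g r * g s \<longrightarrow> \<mu> p * \<mu> q = \<mu> r * \<mu> s)"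
proof -
  have G: "finite G" "x \<in> G" using I x by (auto simp: G_def)
  have "Z \<subseteq> G \<Longrightarrow> \<exists>\<mu>. \<forall>t. x ^ t \<notin> ideal_part G ((\<lambda>z. z - scl (\<mu> z) x) ` Z \<union> L) t" if "finite Z" for Z
    using that
  proof (induction Z)
    case (insert z Z)
    then obtain \<mu> where \<mu>: "\<And>t. x ^ t \<notin> ideal_part G ((\<lambda>z. z - scl (\<mu> z) x) ` Z \<union> L) t" by blast
    then obtain m where m: "\<And>t. x ^ t \<notin> ideal_part G (insert (z - scl m x) ((\<lambda>z. z - scl (\<mu> z) x) ` Z \<union> L)) t"
      using ideal_part_extend[OF G(1,2), of z] insert.prems by blast
    have "(\<lambda>w. w - scl ((\<mu>(z := m)) w) x) ` insert z Z = insert (z - scl m x) ((\<lambda>z. z - scl (\<mu> z) x) ` Z)"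
      using insert.hyps by auto
    then show ?case
      using m by (intro exI[of _ "\<mu>(z := m)"]) auto
  qed (use good in auto)
  from this[OF G(1)] obtain \<mu> where
    \<mu>: "\<And>t. x ^ t \<notin> ideal_part G ((\<lambda>z. z - scl (\<mu> z) x) ` G \<union> L) t" by auto
  define M where "M = (\<lambda>z. z - scl (\<mu> z) x) ` G \<union> L"
  \<comment> \<open>The coefficient of \<open>x ^ t\<close> is well defined modulo the ideal; this
    turns each congruence below into an equation between numbers.\<close>
  have zero: "c = 0" if "scl c (x ^ t) \<in> ideal_part G M t" for c t
  proof (rule ccontr)
    assume "c \<noteq> 0"
    then have "scl (1 / c) (scl c (x ^ t)) = x ^ t" by (simp add: pointwise)
    then show False using ideal_part_scl[OF that, of "1 / c"] \<mu>[of t] by (simp add: M_def)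
  qed
  have lin: "z - scl (\<mu> z) x \<in> ideal_part G M 1" if "z \<in> G" for z
    using that by (intro ideal_part_base) (auto simp: M_def)
  have x1: "x \<in> forms G 1" using G generator_in_forms by blast
  show ?thesis
  proof (intro exI[of _ "\<mu> \<circ> g"] conjI allI impI ballI)
    have "\<mu> x \<noteq> 0"
    proof
      assume "\<mu> x = 0"
      then have "scl 1 (x ^ 1) \<in> ideal_part G M 1"
        using lin[OF G(2)] by simp
      then show False using zero by fastforce
    qed
    then show "\<exists>i\<in>I. (\<mu> \<circ> g) i \<noteq> 0" using x by (auto simp: G_def)
  next
    fix c assume c: "(\<Sum>i\<in>I. scl (c i) (g i)) \<in> L"
    have "(\<Sum>i\<in>I. scl (c i) (g i)) - (\<Sum>i\<in>I. scl (c i) (g i - scl (\<mu> (g i)) x)) \<in> ideal_part G M 1"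
      using c by (intro ideal_part_diff ideal_part_sum ideal_part_scl lin ideal_part_base) (auto simp: M_def G_def)
    also have "(\<Sum>i\<in>I. scl (c i) (g i)) - (\<Sum>i\<in>I. scl (c i) (g i - scl (\<mu> (g i)) x)) = scl (\<Sum>i\<in>I. c i * (\<mu> \<circ> g) i) (x ^ 1)"
      by (simp add: pointwise sum_subtractf[symmetric] sum_distrib_left sum_distrib_right algebra_simps)
    finally show "(\<Sum>i\<in>I. c i * (\<mu> \<circ> g) i) = 0" by (rule zero)
  next
    fix p' q' r' s' assume **: "p' \<in> I" "q' \<in> I" "r' \<in> I" "s' \<in> I" "g p' * g q' = g r' * g s'"
    define p q r s where "p = g p'" and "q = g q'" and "r = g r'" and "s = g s'"
    note defs = this
    have *: "p \<in> G" "q \<in> G" "r \<in> G" "s \<in> G" "p * q = r * s"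
      using ** by (auto simp: defs G_def)
    have prod: "p * q - scl (\<mu> p * \<mu> q) (x ^ 2) \<in> ideal_part G M (1 + 1)" if "p \<in> G" "q \<in> G" for p q
    proof -
      have "(p - scl (\<mu> p) x) * q + (q - scl (\<mu> q) x) * scl (\<mu> p) x \<in> ideal_part G M (1 + 1)"
        using that generator_in_forms[of q G] x1
        by (intro ideal_part_add ideal_part_mult lin) (auto simp: forms_def intro: fv.span_scale)
      also have "(p - scl (\<mu> p) x) * q + (q - scl (\<mu> q) x) * scl (\<mu> p) x = p * q - scl (\<mu> p * \<mu> q) (x ^ 2)"
        by (simp add: pointwise algebra_simps power2_eq_square)
      finally show ?thesis .
    qed
    have "(r * s - scl (\<mu> r * \<mu> s) (x ^ 2)) - (p * q - scl (\<mu> p * \<mu> q) (x ^ 2)) \<in> ideal_part G M (1 + 1)"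
      using * by (intro ideal_part_diff prod)
    also have "(r * s - scl (\<mu> r * \<mu> s) (x ^ 2)) - (p * q - scl (\<mu> p * \<mu> q) (x ^ 2))
      = scl (\<mu> p * \<mu> q - \<mu> r * \<mu> s) (x ^ (1 + 1))"
      using *(5) by (simp add: pointwise algebra_simps power2_eq_square)
    finally show "(\<mu> \<circ> g) p' * (\<mu> \<circ> g) q' = (\<mu> \<circ> g) r' * (\<mu> \<circ> g) s'"
      using zero unfolding defs by fastforce
  qed
qed

subsection \<open>Growth of the graded components\<close>

text \<open>Pigeonhole on exponents: a monomial of positive degree at least
  \<open>card G * n\<close> has some exponent at least \<open>n\<close>, and that power of a
  generator already lies in the ideal.\<close>

lemma forms_subset_ideal_part:
  assumes "finite G" and nil: "\<And>x. x \<in> G \<Longrightarrow> x ^ n \<in> ideal_part G L n" and t: "card G * n \<le> t" "0 < t"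
    and "u \<in> forms G t"
  shows "u \<in> ideal_part G L t"
proof -
  have expo: "\<exists>e. a = (\<Prod>x\<in>G. x ^ e x) \<and> (\<Sum>x\<in>G. e x) = t" if "a \<in> prods G t" for a t
    using that
  proof (induction t arbitrary: a)
    case 0
    then show ?case by (intro exI[of _ "\<lambda>_. 0"]) auto
  next
    case (Suc t)
    then obtain g m where gm: "a = g * m" "g \<in> G" "m \<in> prods G t" by auto
    with Suc.IH obtain e where e: "m = (\<Prod>x\<in>G. x ^ e x)" "(\<Sum>x\<in>G. e x) = t" by blast
    show ?case
    proof (intro exI[of _ "e(g := Suc (e g))"] conjI)
      have "(\<Prod>x\<in>G. x ^ (e(g := Suc (e g))) x) = g ^ Suc (e g) * (\<Prod>x\<in>G-{g}. x ^ e x)"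
        using assms(1) gm(2) by (subst prod.remove[of _ g]) (auto intro!: prod.cong)
      also have "\<dots> = a"
        using assms(1) gm(2) unfolding gm(1) e(1) by (subst (2) prod.remove[of _ g]) (auto simp: mult.assoc)
      finally show "a = (\<Prod>x\<in>G. x ^ (e(g := Suc (e g))) x)" by simp
      have "(\<Sum>x\<in>G. (e(g := Suc (e g))) x) = Suc (e g) + (\<Sum>x\<in>G-{g}. e x)"
        using assms(1) gm(2) by (subst sum.remove[of _ g]) (auto intro!: sum.cong)
      also have "\<dots> = Suc t"
        using assms(1) gm(2) e(2) sum.remove[of G g e] by simp
      finally show "(\<Sum>x\<in>G. (e(g := Suc (e g))) x) = Suc t" .
    qed
  qed
  have "a \<in> ideal_part G L t" if "a \<in> prods G t" for a
  proof -
    obtain e where e: "a = (\<Prod>x\<in>G. x ^ e x)" "(\<Sum>x\<in>G. e x) = t"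
      using expo[OF \<open>a \<in> prods G t\<close>] by blast
    have "\<exists>x\<in>G. n \<le> e x"
    proof (rule ccontr)
      assume neg: "\<not> ?thesis"
      have "G \<noteq> {}" using e(2) t(2) by auto
      then have "(\<Sum>x\<in>G. e x) < (\<Sum>x\<in>G. n)"
        using neg assms(1) by (intro sum_strict_mono) auto
      then show False using e(2) t(1) by simp
    qed
    then obtain x where x: "x \<in> G" "n \<le> e x" by blast
    have "(\<Prod>y\<in>F. y ^ e y) \<in> forms G (\<Sum>y\<in>F. e y)" if "F \<subseteq> G" for F
      using finite_subset[OF that assms(1)] that
    proof (induction F)
      case empty
      then show ?case by (simp add: one_in_forms)
    next
      case (insert y F)
      then have "y ^ e y * (\<Prod>y\<in>F. y ^ e y) \<in> forms G (e y + (\<Sum>y\<in>F. e y))"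
        using generator_in_forms by (intro forms_mult power_in_forms) auto
      then show ?case using insert.hyps by simp
    qed
    then have "(\<Prod>y\<in>G-{x}. y ^ e y) \<in> forms G (\<Sum>y\<in>G-{x}. e y)" by blast
    then have "x ^ n * (x ^ (e x - n) * (\<Prod>y\<in>G-{x}. y ^ e y))
        \<in> ideal_part G L (n + ((e x - n) + (\<Sum>y\<in>G-{x}. e y)))"
      using x(1) generator_in_forms by (intro ideal_part_mult nil forms_mult power_in_forms) auto
    also have "x ^ n * (x ^ (e x - n) * (\<Prod>y\<in>G-{x}. y ^ e y)) = a"
      using assms(1) x e(1) by (subst mult.assoc[symmetric]) (simp add: power_add[symmetric] prod.remove[of G x])
    also have "n + ((e x - n) + (\<Sum>y\<in>G-{x}. e y)) = t"
      using assms(1) x e(2) by (simp add: sum.remove[of G x])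
    finally show ?thesis .
  qed
  then have "fv.span (prods G t) \<subseteq> ideal_part G L t"
    unfolding ideal_part_def by (intro fv.span_minimal) auto
  then show ?thesis
    using assms(5) by (auto simp: forms_def)
qed

text \<open>The last part is determined by the others, so dropping it is injective. The compositions
  serve as exponent vectors of monomials of degree \<open>s\<close> in \<open>m + 1\<close> linear
  forms.\<close>

lemma card_compositions_le:
  "finite {\<alpha>\<in>{..<Suc m} \<rightarrow>\<^sub>E {..s}. sum \<alpha> {..<Suc m} = s} \<and>
   card {\<alpha>\<in>{..<Suc m} \<rightarrow>\<^sub>E {..s}. sum \<alpha> {..<Suc m} = s} \<le> (s + 1) ^ m"
proof
  let ?A = "{\<alpha>\<in>{..<Suc m} \<rightarrow>\<^sub>E {..s}. sum \<alpha> {..<Suc m} = (s::nat)}"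
  let ?r = "\<lambda>\<alpha>. restrict \<alpha> {..<m}"
  show "finite ?A"
    by (rule finite_subset[of _ "{..<Suc m} \<rightarrow>\<^sub>E {..s}"]) (auto intro!: finite_PiE)
  have "inj_on ?r ?A"
  proof (rule inj_onI)
    fix \<alpha> \<beta> assume *: "\<alpha> \<in> ?A" "\<beta> \<in> ?A" "?r \<alpha> = ?r \<beta>"
    have eq: "\<alpha> i = \<beta> i" if "i < m" for i
      using fun_cong[OF *(3), of i] that by simp
    then have "sum \<alpha> {..<m} = sum \<beta> {..<m}" by simp
    then have "\<alpha> m = \<beta> m"
      using *(1,2) by auto
    then show "\<alpha> = \<beta>"
      using * eq by (intro PiE_ext[of _ "{..<Suc m}"]) (auto simp: less_Suc_eq)
  qed
  moreover have "?r ` ?A \<subseteq> {..<m} \<rightarrow>\<^sub>E {..s}"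
    by (auto simp: PiE_iff extensional_def split: if_splits)
  ultimately have "card ?A \<le> card ({..<m} \<rightarrow>\<^sub>E {..s})"
    by (intro card_inj_on_le) (auto intro!: finite_PiE)
  then show "card ?A \<le> (s + 1) ^ m"
    by (simp add: card_PiE)
qed

text \<open>Above degree \<open>N\<close> every form lies in the ideal, so factors
  \<open>f i\<close> can be split off until degree \<open>N\<close> is reached. Hence degree
  \<open>N + s\<close> is spanned by the products of a monomial of degree \<open>s\<close> in the
  \<open>f i\<close> with one of the finitely many elements of \<open>prods G N\<close>.\<close>

lemma hilbert_function_bound:
  fixes f :: "nat \<Rightarrow> 'x \<Rightarrow> complex"
  assumes G: "finite G" and nil: "\<And>x. x \<in> G \<Longrightarrow> \<exists>t. x ^ t \<in> ideal_part G (f ` {..<Suc m}) t"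
  shows "\<exists>D N. \<forall>s S. fv.independent S \<longrightarrow> S \<subseteq> forms G (N + s) \<longrightarrow> card S \<le> D * (s + 1) ^ m"
proof -
  let ?L = "f ` {..<Suc m}"
  obtain n where n: "\<And>x. x \<in> G \<Longrightarrow> x ^ n x \<in> ideal_part G ?L (n x)"
    using nil by metis
  define n0 where "n0 = (\<Sum>x\<in>G. n x)"
  have n0: "x ^ n0 \<in> ideal_part G ?L n0" if "x \<in> G" for x
  proof -
    have "n x \<le> n0" unfolding n0_def using that G by (intro member_le_sum) auto
    then show ?thesis
      using ideal_part_mult[OF n[OF that] power_in_forms[OF generator_in_forms[OF that]], of "n0 - n x"]
      by (simp add: power_add[symmetric])
  qed
  define N where "N = card G * n0"
  have step: "u \<in> ideal_part G ?L (N + Suc s)" if "u \<in> forms G (N + Suc s)" for u s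
    using forms_subset_ideal_part[OF G n0 _ _ that] by (simp add: N_def)
  define E where "E = (\<lambda>s::nat. {\<alpha>\<in>{..<Suc m} \<rightarrow>\<^sub>E {..s}. sum \<alpha> {..<Suc m} = s})"
  define B where "B = (\<lambda>s. (\<lambda>(\<alpha>, r). (\<Prod>i<Suc m. f i ^ \<alpha> i) * r) ` (E s \<times> prods G N))"
  have "forms G (N + s) \<subseteq> fv.span (B s)" for s
  proof (induction s)
    case 0
    have "prods G N \<subseteq> B 0"
    proof
      fix r assume "r \<in> prods G N"
      moreover have "(\<lambda>i\<in>{..<Suc m}. 0) \<in> E 0" by (auto simp: E_def)
      moreover have "(\<Prod>i<Suc m. f i ^ (\<lambda>i\<in>{..<Suc m}. 0) i) * r = r" by simp
      ultimately show "r \<in> B 0" unfolding B_def by force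
    qed
    then show ?case by (simp add: forms_def fv.span_mono)
  next
    case (Suc s)
    have "l * r \<in> fv.span (B (Suc s))" if "l \<in> ?L" "r \<in> forms G (N + s)" for l r
    proof (rule span_times)
      show "l \<in> fv.span {l}" by (simp add: fv.span_base)
      show "r \<in> fv.span (B s)" using Suc that by blast
      fix l' b assume "l' \<in> {l}" "b \<in> B s"
      then obtain \<alpha> r' where b: "b = (\<Prod>i<Suc m. f i ^ \<alpha> i) * r'" "\<alpha> \<in> E s" "r' \<in> prods G N"
        by (auto simp: B_def)
      obtain j where j: "l = f j" "j < Suc m" using \<open>l \<in> ?L\<close> by blast
      have "l' * b = (\<Prod>i<Suc m. f i ^ (\<alpha>(j := Suc (\<alpha> j))) i) * r'"
      proof -
        have "(\<Prod>i<Suc m. f i ^ (\<alpha>(j := Suc (\<alpha> j))) i) = f j ^ Suc (\<alpha> j) * (\<Prod>i\<in>{..<Suc m}-{j}. f i ^ \<alpha> i)"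
          using j(2) by (subst prod.remove[of _ j]) (auto intro!: prod.cong)
        also have "\<dots> = f j * (\<Prod>i<Suc m. f i ^ \<alpha> i)"
          using j(2) by (subst (2) prod.remove[of _ j]) (auto simp: mult.assoc)
        finally show ?thesis using \<open>l' \<in> {l}\<close> j b(1) by (simp add: mult.assoc)
      qed
      moreover have "\<alpha>(j := Suc (\<alpha> j)) \<in> E (Suc s)"
      proof -
        have "sum (\<alpha>(j := Suc (\<alpha> j))) {..<Suc m} = Suc (\<alpha> j) + sum \<alpha> ({..<Suc m}-{j})"
          using j(2) by (subst sum.remove[of _ j]) (auto intro!: sum.cong)
        also have "\<dots> = Suc s"
          using b(2) j(2) sum.remove[of "{..<Suc m}" j \<alpha>] by (simp add: E_def)
        finally have sum: "sum (\<alpha>(j := Suc (\<alpha> j))) {..<Suc m} = Suc s" .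
        have "(\<alpha>(j := Suc (\<alpha> j))) i \<le> Suc s" if "i < Suc m" for i
          unfolding sum[symmetric] using that by (intro member_le_sum) auto
        then show ?thesis
          using b(2) j(2) sum by (auto simp: E_def PiE_iff extensional_def)
      qed
      ultimately show "l' * b \<in> fv.span (B (Suc s))"
        using b(3) by (intro fv.span_base) (force simp: B_def)
    qed
    then have "{l * r |l r s'. l \<in> ?L \<and> r \<in> forms G s' \<and> N + Suc s = Suc s'} \<subseteq> fv.span (B (Suc s))"
      by auto
    then have "ideal_part G ?L (N + Suc s) \<subseteq> fv.span (B (Suc s))"
      unfolding ideal_part_def by (intro fv.span_minimal) auto
    then show ?case using step by blast
  qed
  moreover have "finite (B s)" for s
    unfolding B_def E_def using card_compositions_le[of m s] finite_prods[OF G]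
    by (intro finite_imageI finite_cartesian_product) blast+
  moreover have "card (B s) \<le> card (prods G N) * (s + 1) ^ m" for s
  proof -
    have "card (B s) \<le> card (E s \<times> prods G N)"
      unfolding B_def E_def using card_compositions_le[of m s] finite_prods[OF G]
      by (intro card_image_le finite_cartesian_product) blast+
    also have "\<dots> = card (E s) * card (prods G N)" by (rule card_cartesian_product)
    also have "\<dots> \<le> (s + 1) ^ m * card (prods G N)"
      using card_compositions_le[of m s] unfolding E_def by (intro mult_right_mono) auto
    finally show ?thesis by (simp add: mult.commute)
  qed
  ultimately have "card S \<le> card (prods G N) * (s + 1) ^ m"
    if "fv.independent S" "S \<subseteq> forms G (N + s)" for S s
    using fv.independent_span_bound[of "B s" S] that by (meson order_trans)
  then show ?thesis by blast
qed

subsection \<open>Product vectors mapped to product vectors\<close>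

lemma positional_inj:
  fixes e e' :: "nat \<Rightarrow> nat"
  assumes "(\<Sum>i<n. e i * B ^ i) = (\<Sum>i<n. e' i * B ^ i)"
    "\<And>i. i < n \<Longrightarrow> e i < B" "\<And>i. i < n \<Longrightarrow> e' i < B" "i < n"
  shows "e i = e' i"
  using assms
proof (induction n arbitrary: e e' i)
  case (Suc n)
  have split: "(\<Sum>i<Suc n. e i * B ^ i) = e 0 + B * (\<Sum>i<n. e (Suc i) * B ^ i)" for e :: "nat \<Rightarrow> nat"
    by (subst sum.lessThan_Suc_shift) (simp add: sum_distrib_left ac_simps)
  have lt: "e 0 < B" "e' 0 < B" using Suc.prems by auto
  have eq: "e 0 + B * (\<Sum>i<n. e (Suc i) * B ^ i) = e' 0 + B * (\<Sum>i<n. e' (Suc i) * B ^ i)"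
    using Suc.prems(1) unfolding split .
  from arg_cong[OF eq, of "\<lambda>x. x mod B"] have 0: "e 0 = e' 0" using lt by simp
  with eq lt have "(\<Sum>i<n. e (Suc i) * B ^ i) = (\<Sum>i<n. e' (Suc i) * B ^ i)" by auto
  with Suc.IH[of "\<lambda>i. e (Suc i)" "\<lambda>i. e' (Suc i)"] Suc.prems have "e (Suc i) = e' (Suc i)" if "i < n" for i
    using that by auto
  with 0 show ?case using \<open>i < Suc n\<close> by (cases i) auto
qed simp

text \<open>The point \<open>v\<close> consists of four vectors, and \<open>s\<close> selects the
  pair \<open>v 0\<close>, \<open>v 1\<close> or the pair \<open>v 2\<close>, \<open>v 3\<close>:
  these are the entries of two independent matrices of rank at most one.\<close>

definition seg :: "nat \<times> nat \<times> nat \<Rightarrow> (nat \<Rightarrow> nat \<Rightarrow> complex) \<Rightarrow> complex" where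
  "seg = (\<lambda>(s, i, j) v. v (2 * s) i * v (Suc (2 * s)) j)"

definition seg_index :: "(nat \<times> nat \<times> nat) set" where
  "seg_index = {..<2} \<times> {..<3} \<times> {..<3}"

text \<open>The first row and the first column of each of the two matrices. They determine a generic
  rank-one matrix, and five is the dimension of the cone of such \<open>3 \<times> 3\<close>
  matrices.\<close>

definition seg_free :: "nat \<Rightarrow> (nat \<Rightarrow> nat \<Rightarrow> complex) \<Rightarrow> complex" where
  "seg_free n = seg ([(0,0,0), (0,0,1), (0,0,2), (0,1,0), (0,2,0), (1,0,0), (1,0,1), (1,0,2), (1,1,0), (1,2,0)] ! n)"

lemma seg_free_in: "n < 10 \<Longrightarrow> seg_free n \<in> seg ` seg_index"
  unfolding seg_free_def by (intro imageI) (auto simp: seg_index_def eval_nat_numeral less_Suc_eq)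

text \<open>The ten generators \<open>seg_free n\<close> are algebraically independent, as one sees on the curve
  along which the \<open>Suc i\<close>-th of them is \<open>z ^ (B ^ i)\<close> and the \<open>0\<close>-th is \<open>1\<close>.\<close>

definition seg_curve :: "nat \<Rightarrow> complex \<Rightarrow> nat \<Rightarrow> nat \<Rightarrow> complex" where
  "seg_curve B z p i = z ^ ([[0, B^2, B^3], [0, 1, B], [0, B^7 - B^4, B^8 - B^4], [B^4, B^5, B^6]] ! p ! i)"

text \<open>The exponents of the third vector have \<open>B^4\<close> subtracted because the fourth
  vector starts with \<open>z ^ (B^4)\<close> rather than \<open>1\<close>; this matters for the
  coordinates \<open>(1, 1, 0)\<close> and \<open>(1, 2, 0)\<close>.\<close>

lemma seg_free_curve:
  assumes "0 < B"
  shows "seg_free 0 (seg_curve B z) = 1" and "i < 9 \<Longrightarrow> seg_free (Suc i) (seg_curve B z) = z ^ (B ^ i)"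
proof -
  have "B ^ 4 \<le> B ^ 7" "B ^ 4 \<le> B ^ 8"
    using assms by (intro power_increasing; simp)+
  then have *: "z ^ (B^7 - B^4) * z ^ (B^4) = z ^ (B^7)" "z ^ (B^8 - B^4) * z ^ (B^4) = z ^ (B^8)"
    by (simp_all flip: power_add)
  show "seg_free 0 (seg_curve B z) = 1"
    by (simp add: seg_free_def seg_def seg_curve_def)
  assume "i < 9"
  then consider "i = 0" | "i = 1" | "i = 2" | "i = 3" | "i = 4" | "i = 5" | "i = 6" | "i = 7" | "i = 8"
    by linarith
  then show "seg_free (Suc i) (seg_curve B z) = z ^ (B ^ i)"
    by cases (simp_all add: seg_free_def seg_def seg_curve_def * nth_Cons' numeral_2_eq_2)
qed

text \<open>Take the monomials in nine of the coordinates with exponents below \<open>q\<close>,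
  padded by a power of \<open>seg_free 0\<close> to degree \<open>9 * q\<close>. On the curve they
  become distinct powers of \<open>z\<close>, since their exponents are the base \<open>q\<close>
  digits of the resulting power.\<close>

lemma seg_growth:
  assumes "0 < q"
  shows "\<exists>S. fv.independent S \<and> S \<subseteq> forms (seg ` seg_index) (9 * q) \<and> card S = q ^ 9"
proof -
  define E where "E = {..<9::nat} \<rightarrow>\<^sub>E {..<q}"
  define M where "M = (\<lambda>e. seg_free 0 ^ (9 * q - (\<Sum>i<9. e i)) * (\<Prod>i<9. seg_free (Suc i) ^ e i))"
  define W where "W = (\<lambda>e. \<Sum>i<9. e i * q ^ i)"
  have finE: "finite E" unfolding E_def by (intro finite_PiE) auto
  have M_curve: "M e (seg_curve q z) = z ^ W e" for e z
    using assms by (simp add: M_def W_def pointwise seg_free_curve power_sum power_mult[symmetric] mult.commute)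
  have inj_W: "e = e'" if "e \<in> E" "e' \<in> E" "W e = W e'" for e e'
  proof (rule PiE_ext[of _ "{..<9}" "\<lambda>_. {..<q}"])
    fix i :: nat assume "i \<in> {..<9}"
    then show "e i = e' i"
      using that unfolding W_def E_def by (intro positional_inj[of e q 9 e' i]) auto
  qed (use that in \<open>auto simp: E_def\<close>)
  have inj_M: "inj_on M E"
  proof (rule inj_onI)
    fix e e' assume *: "e \<in> E" "e' \<in> E" "M e = M e'"
    \<comment> \<open>The point \<open>z = 2\<close> of the curve separates all powers of
      \<open>z\<close>.\<close>
    have "(2::complex) ^ W e = 2 ^ W e'"
      using arg_cong[OF *(3), of "\<lambda>h. h (seg_curve q 2)"] by (simp add: M_curve)
    then have "(of_nat (2 ^ W e) :: complex) = of_nat (2 ^ W e')" by simp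
    then have "(2::nat) ^ W e = 2 ^ W e'" unfolding of_nat_eq_iff .
    then show "e = e'" using inj_W * by simp
  qed
  have "M e \<in> forms (seg ` seg_index) (9 * q)" if "e \<in> E" for e
  proof -
    have gen: "seg_free i \<in> forms (seg ` seg_index) 1" if "i < 10" for i
      using seg_free_in[OF that] by (rule generator_in_forms)
    have "(\<Prod>i<n. seg_free (Suc i) ^ e i) \<in> forms (seg ` seg_index) (\<Sum>i<n. e i)" if "n \<le> 9" for n
      using that
    proof (induction n)
      case (Suc n)
      then show ?case using gen[of "Suc n"] forms_mult[OF Suc.IH power_in_forms] by simp
    qed (simp add: one_in_forms)
    from this[of 9] have "M e \<in> forms (seg ` seg_index) ((9 * q - (\<Sum>i<9. e i)) + (\<Sum>i<9. e i))"
      unfolding M_def using gen[of 0] by (intro forms_mult power_in_forms) auto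
    moreover have "(\<Sum>i<9. e i) \<le> (\<Sum>i<9::nat. q)"
      using that by (intro sum_mono) (auto simp: E_def PiE_iff intro: less_imp_le)
    ultimately show ?thesis by simp
  qed
  moreover have "c m = 0" if c: "(\<Sum>m\<in>M ` E. scl (c m) m) = 0" and "m \<in> M ` E" for c m
  proof -
    obtain e where e: "e \<in> E" "m = M e" using \<open>m \<in> M ` E\<close> by blast
    \<comment> \<open>On the curve a linear relation becomes a polynomial in \<open>z\<close> that
      vanishes everywhere, and its coefficients are those of the relation.\<close>
    define p where "p = (\<Sum>e\<in>E. monom (c (M e)) (W e))"
    have "poly p z = 0" for z
    proof -
      have "(\<Sum>m\<in>M ` E. scl (c m) m) (seg_curve q z) = 0"
        by (simp add: c zero_fun_apply)
      then show ?thesis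
        by (simp add: p_def poly_sum poly_monom sum.reindex[OF inj_M] pointwise M_curve)
    qed
    then have "p = 0" using poly_all_0_iff_0 by blast
    then have "0 = coeff p (W e)" by simp
    also have "\<dots> = (\<Sum>e'\<in>E. if e' = e then c (M e') else 0)"
      unfolding p_def coeff_sum coeff_monom using e inj_W by (intro sum.cong) auto
    also have "\<dots> = c m" using e finE by simp
    finally have "0 = c m" .
    then show ?thesis by (rule sym)
  qed
  then have "\<forall>c. (\<Sum>m\<in>M ` E. scl (c m) m) = 0 \<longrightarrow> (\<forall>m\<in>M ` E. c m = 0)"
    by blast
  then have "fv.independent (M ` E)"
    unfolding fv.dependent_finite[OF finite_imageI[OF finE]] by blast
  moreover have "card (M ` E) = q ^ 9"
    unfolding card_image[OF inj_M] by (simp add: E_def card_PiE)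
  ultimately show ?thesis by blast
qed

section \<open>Rank-one matrices and the intersection point\<close>

text \<open>A nonzero entry serves as pivot: its column, and its row divided by it, are the two
  factors.\<close>

lemma rank_one_factor:
  fixes P :: "nat \<Rightarrow> nat \<Rightarrow> complex"
  assumes "\<And>i j k l. i < m \<Longrightarrow> j < n \<Longrightarrow> k < m \<Longrightarrow> l < n \<Longrightarrow> P i j * P k l = P i l * P k j"
  shows "\<exists>a b. \<forall>i<m. \<forall>j<n. P i j = a i * b j"
proof (cases "\<exists>k<m. \<exists>l<n. P k l \<noteq> 0")
  case True
  then obtain k l where kl: "k < m" "l < n" "P k l \<noteq> 0" by blast
  then show ?thesis
    using assms[OF _ _ kl(1,2)] by (intro exI[of _ "\<lambda>i. P i l"] exI[of _ "\<lambda>j. P k j / P k l"]) (auto simp: field_simps)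
qed (auto intro!: exI[of _ "\<lambda>_. 0"])

lemma sum_seg_index:
  "sum h seg_index = (\<Sum>i<3. \<Sum>j<3. h (0, i, j)) + (\<Sum>i<3. \<Sum>j<3. h (1, i, j))"
  unfolding seg_index_def unfolding sum.cartesian_product' by (simp add: numeral_2_eq_2)

lemma seg_minor: "seg (s, i, j) * seg (s, k, l) = seg (s, i, l) * seg (s, k, j)"
  by (simp add: seg_def pointwise ac_simps)

lemma product_to_product:
  fixes T :: op2
  shows "\<exists>a b c d. (\<exists>i<3. \<exists>j<3. a i * b j \<noteq> 0) \<and>
    (\<forall>k<3. \<forall>l<3. (\<Sum>i<3. \<Sum>j<3. T i j k l * a i * b j) = c k * d l)"
proof -
  \<comment> \<open>The nine linear forms: for \<open>n = 3 * k + l\<close>, the form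
    \<open>f n\<close> is the \<open>(k, l)\<close> entry of the image of the first product vector
    minus the \<open>(k, l)\<close> entry of the second.\<close>
  define C where "C = (\<lambda>n (s::nat, i, j). if s = 0 then T i j (n div 3) (n mod 3)
     else if i = n div 3 \<and> j = n mod 3 then -1 else (0::complex))"
  define f where "f = (\<lambda>n. \<Sum>z\<in>seg_index. scl (C n z) (seg z))"
  have fin: "finite seg_index" by (simp add: seg_index_def)
  have "\<exists>x\<in>seg ` seg_index. \<forall>t. x ^ t \<notin> ideal_part (seg ` seg_index) (f ` {..<Suc 8}) t"
  proof (rule ccontr)
    assume "\<not> ?thesis"
    then obtain D N where DN: "\<And>s S. fv.independent S \<Longrightarrow> S \<subseteq> forms (seg ` seg_index) (N + s) \<Longrightarrow>
       card S \<le> D * (s + 1) ^ 8"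
      using hilbert_function_bound[of "seg ` seg_index" f 8] fin by blast
    \<comment> \<open>The summand \<open>N\<close> puts the degree \<open>9 * q\<close> in the range
      of the bound; the summand \<open>D * 10 ^ 8 + 1\<close> lets \<open>q ^ 9\<close> exceed
      \<open>D * (10 * q) ^ 8\<close>.\<close>
    define q where "q = N + D * 10 ^ 8 + 1"
    obtain S where S: "fv.independent S" "S \<subseteq> forms (seg ` seg_index) (9 * q)" "card S = q ^ 9"
      using seg_growth[of q] by (auto simp: q_def)
    have "N + (9 * q - N) = 9 * q" by (simp add: q_def)
    then have "q ^ 9 \<le> D * ((9 * q - N) + 1) ^ 8"
      using DN[OF S(1), of "9 * q - N"] S(2,3) by simp
    also have "\<dots> \<le> D * (10 * q) ^ 8"
      by (intro mult_left_mono power_mono) (auto simp: q_def)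
    also have "\<dots> = D * 10 ^ 8 * q ^ 8" by (simp only: power_mult_distrib mult.assoc)
    also have "\<dots> < q * q ^ 8"
      by (intro mult_strict_right_mono) (auto simp: q_def)
    finally show False by (simp flip: power_Suc)
  qed
  then obtain x where x: "x \<in> seg ` seg_index" "\<And>t. x ^ t \<notin> ideal_part (seg ` seg_index) (f ` {..<Suc 8}) t"
    by blast
  obtain \<mu> where \<mu>0: "\<exists>z\<in>seg_index. \<mu> z \<noteq> 0"
    and \<mu>1: "\<forall>c. (\<Sum>z\<in>seg_index. scl (c z) (seg z)) \<in> f ` {..<Suc 8} \<longrightarrow> (\<Sum>z\<in>seg_index. c z * \<mu> z) = 0"
    and \<mu>2: "\<forall>p\<in>seg_index. \<forall>q\<in>seg_index. \<forall>r\<in>seg_index. \<forall>s\<in>seg_index.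
       seg p * seg q = seg r * seg s \<longrightarrow> \<mu> p * \<mu> q = \<mu> r * \<mu> s"
    using ideal_part_common_zero[OF fin x] by (elim exE conjE) (rule that)
  \<comment> \<open>The quadratic relations among the generators force both halves of
    \<open>\<mu>\<close> to be matrices of rank at most one.\<close>
  have minor: "\<mu> (s, i, j) * \<mu> (s, k, l) = \<mu> (s, i, l) * \<mu> (s, k, j)"
    if "s < 2" "i < 3" "j < 3" "k < 3" "l < 3" for s i j k l
    by (rule \<mu>2[rule_format, OF _ _ _ _ seg_minor]) (use that in \<open>auto simp: seg_index_def\<close>)
  have lin: "(\<Sum>i<3. \<Sum>j<3. T i j k l * \<mu> (0, i, j)) = \<mu> (1, k, l)" if "k < 3" "l < 3" for k l
  proof -
    define n where "n = 3 * k + l"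
    have n: "n < Suc 8" "n div 3 = k" "n mod 3 = l" using that by (auto simp: n_def)
    have "0 = (\<Sum>z\<in>seg_index. C n z * \<mu> z)"
      using \<mu>1[rule_format, of "C n"] n(1) by (simp add: f_def)
    also have "\<dots> = (\<Sum>i<3. \<Sum>j<3. T i j k l * \<mu> (0, i, j)) + (\<Sum>i<3. \<Sum>j<3. if i = k then if j = l then - \<mu> (1, i, j) else 0 else 0)"
      unfolding sum_seg_index by (intro arg_cong2[of _ _ _ _ "(+)"] sum.cong) (auto simp: C_def n)
    also have "(\<Sum>i<3. \<Sum>j<3. if i = k then if j = l then - \<mu> (1, i, j) else 0 else 0) = - \<mu> (1, k, l)"
    proof -
      have "(\<Sum>j<3. if i = k then if j = l then - \<mu> (1, i, j) else 0 else 0) = (if i = k then - \<mu> (1, k, l) else 0)" for i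
        using that by (cases "i = k") auto
      then show ?thesis using that by simp
    qed
    finally show ?thesis by simp
  qed
  obtain a b where ab: "\<And>i j. i < 3 \<Longrightarrow> j < 3 \<Longrightarrow> \<mu> (0, i, j) = a i * b j"
    using rank_one_factor[of 3 3 "\<lambda>i j. \<mu> (0, i, j)"] minor[of 0] by auto
  obtain c d where cd: "\<And>i j. i < 3 \<Longrightarrow> j < 3 \<Longrightarrow> \<mu> (1, i, j) = c i * d j"
    using rank_one_factor[of 3 3 "\<lambda>i j. \<mu> (1, i, j)"] minor[of 1] by auto
  show ?thesis
  proof (rule exI[of _ a], rule exI[of _ b], rule exI[of _ c], rule exI[of _ d], intro conjI allI impI)
    fix k l :: nat assume kl: "k < 3" "l < 3"
    then show "(\<Sum>i<3. \<Sum>j<3. T i j k l * a i * b j) = c k * d l"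
      using lin[OF kl] ab cd by (simp add: mult.assoc)
  next
    show "\<exists>i<3. \<exists>j<3. a i * b j \<noteq> 0"
    proof (rule ccontr)
      assume "\<not> ?thesis"
      \<comment> \<open>If the first half of \<open>\<mu>\<close> vanished, the linear equations
        would make the second half vanish too.\<close>
      then have 0: "\<mu> (0, i, j) = 0" if "i < 3" "j < 3" for i j
        using ab[OF that] that by simp
      then have "\<mu> (1, k, l) = 0" if "k < 3" "l < 3" for k l
        using lin[OF that] by simp
      with 0 \<mu>0 show False by (auto simp: seg_index_def less_2_cases_iff)
    qed
  qed
qed

subsection \<open>Local unitary equivalence of tensors\<close>

definition mmul :: "nat \<Rightarrow> (nat \<Rightarrow> nat \<Rightarrow> complex) \<Rightarrow> (nat \<Rightarrow> nat \<Rightarrow> complex) \<Rightarrow> nat \<Rightarrow> nat \<Rightarrow> complex" where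
  "mmul d u w = (\<lambda>i j. \<Sum>k<d. u i k * w k j)"

definition dagger :: "(nat \<Rightarrow> nat \<Rightarrow> complex) \<Rightarrow> nat \<Rightarrow> nat \<Rightarrow> complex" where
  "dagger u = (\<lambda>i j. cnj (u j i))"

lemma unitary_dagger: "unitary_mat d u \<Longrightarrow> unitary_mat d (dagger u)"
  by (auto simp: unitary_mat_def dagger_def mult.commute)

lemma unitary_transpose:
  assumes "unitary_mat d u"
  shows "unitary_mat d (\<lambda>i j. u j i)"
  using assms by (auto simp: unitary_mat_def mult.commute[of "cnj _"])

lemma sum_delta_double:
  fixes f :: "nat \<Rightarrow> nat \<Rightarrow> complex"
  shows "(\<Sum>a<d. \<Sum>b<d. f a b * (if a = b then 1 else 0)) = (\<Sum>a<d. f a a)"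
  by (simp add: if_distrib cong: if_cong)

lemma gram_left:
  assumes "unitary_mat d w"
  shows "(\<Sum>k<d. cnj (\<Sum>a<d. w k a * f a) * (\<Sum>b<d. w k b * g b)) = (\<Sum>a<d. cnj (f a) * g a)"
proof -
  have "(\<Sum>k<d. cnj (\<Sum>a<d. w k a * f a) * (\<Sum>b<d. w k b * g b))
      = (\<Sum>k<d. \<Sum>a<d. \<Sum>b<d. (cnj (f a) * g b) * (cnj (w k a) * w k b))"
    unfolding cnj_sum sum_product by (simp add: algebra_simps)
  also have "\<dots> = (\<Sum>a<d. \<Sum>k<d. \<Sum>b<d. (cnj (f a) * g b) * (cnj (w k a) * w k b))"
    by (rule sum.swap)
  also have "\<dots> = (\<Sum>a<d. \<Sum>b<d. \<Sum>k<d. (cnj (f a) * g b) * (cnj (w k a) * w k b))"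
    by (intro sum.cong refl sum.swap)
  also have "\<dots> = (\<Sum>a<d. \<Sum>b<d. (cnj (f a) * g b) * (if a = b then 1 else 0))"
    using assms by (intro sum.cong refl) (auto simp: sum_distrib_left[symmetric] unitary_mat_def)
  finally show ?thesis by (simp only: sum_delta_double)
qed

lemma unitary_mmul:
  assumes "unitary_mat d u" "unitary_mat d w"
  shows "unitary_mat d (mmul d u w)"
proof -
  have 1: "(\<Sum>k<d. cnj (mmul d u w k i) * mmul d u w k j) = (if i = j then 1 else 0)"
    if "unitary_mat d u" "unitary_mat d w" "i < d" "j < d" for u w i j
    unfolding mmul_def gram_left[OF that(1)] using that by (simp add: unitary_mat_def)
  have 2: "(\<Sum>k<d. mmul d u w i k * cnj (mmul d u w j k)) = (if i = j then 1 else 0)" if "i < d" "j < d" for i j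
    using 1[OF unitary_dagger[OF assms(2)] unitary_dagger[OF assms(1)] that]
    by (simp add: mmul_def dagger_def mult.commute)
  show ?thesis
    using 1[OF assms] 2 by (simp add: unitary_mat_def)
qed

section \<open>Unitaries acting on single legs of a tensor\<close>

definition site0 :: "nat \<Rightarrow> (nat \<Rightarrow> nat \<Rightarrow> complex) \<Rightarrow> op2 \<Rightarrow> op2" where
  "site0 d w T = (\<lambda>i j k l. \<Sum>a<d. w i a * T a j k l)"
definition site1 :: "nat \<Rightarrow> (nat \<Rightarrow> nat \<Rightarrow> complex) \<Rightarrow> op2 \<Rightarrow> op2" where
  "site1 d w T = (\<lambda>i j k l. \<Sum>a<d. w j a * T i a k l)"
definition site2 :: "nat \<Rightarrow> (nat \<Rightarrow> nat \<Rightarrow> complex) \<Rightarrow> op2 \<Rightarrow> op2" where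
  "site2 d w T = (\<lambda>i j k l. \<Sum>a<d. w k a * T i j a l)"
definition site3 :: "nat \<Rightarrow> (nat \<Rightarrow> nat \<Rightarrow> complex) \<Rightarrow> op2 \<Rightarrow> op2" where
  "site3 d w T = (\<lambda>i j k l. \<Sum>a<d. w l a * T i j k a)"

lemmas site_defs = site0_def site1_def site2_def site3_def

lemma sum_sum_mult:
  "(\<Sum>a<d. u a * (\<Sum>b<d. w a b * x b)) = (\<Sum>b<d. (\<Sum>a<d. u a * w a b) * (x b :: complex))"
  unfolding sum_distrib_left sum_distrib_right
  by (subst sum.swap) (simp add: mult.assoc)

lemma sum_commute_mult:
  "(\<Sum>a<d. u a * (\<Sum>b<d. w b * x a b)) = (\<Sum>b<d. w b * (\<Sum>a<d. u a * (x a b :: complex)))"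
  unfolding sum_distrib_left
  by (subst sum.swap) (simp add: mult.left_commute)

lemma site_comp:
  "site0 d u (site0 d w T) = site0 d (mmul d u w) T"
  "site1 d u (site1 d w T) = site1 d (mmul d u w) T"
  "site2 d u (site2 d w T) = site2 d (mmul d u w) T"
  "site3 d u (site3 d w T) = site3 d (mmul d u w) T"
  unfolding site_defs mmul_def sum_sum_mult by (rule refl)+

lemma site_commute:
  "site1 d u (site0 d w T) = site0 d w (site1 d u T)"
  "site2 d u (site0 d w T) = site0 d w (site2 d u T)"
  "site3 d u (site0 d w T) = site0 d w (site3 d u T)"
  "site2 d u (site1 d w T) = site1 d w (site2 d u T)"
  "site3 d u (site1 d w T) = site1 d w (site3 d u T)"
  "site3 d u (site2 d w T) = site2 d w (site3 d u T)"
  unfolding site_defs by (intro ext sum_commute_mult)+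

definition act :: "nat \<Rightarrow> (nat \<Rightarrow> nat \<Rightarrow> complex) \<Rightarrow> (nat \<Rightarrow> nat \<Rightarrow> complex) \<Rightarrow> (nat \<Rightarrow> nat \<Rightarrow> complex) \<Rightarrow>
    (nat \<Rightarrow> nat \<Rightarrow> complex) \<Rightarrow> op2 \<Rightarrow> op2" where
  "act d w0 w1 w2 w3 T = site0 d w0 (site1 d w1 (site2 d w2 (site3 d w3 T)))"

lemma act_act:
  "act d u0 u1 u2 u3 (act d w0 w1 w2 w3 T) = act d (mmul d u0 w0) (mmul d u1 w1) (mmul d u2 w2) (mmul d u3 w3) T"
  unfolding act_def by (simp only: site_commute site_comp)

definition tensor_eq :: "nat \<Rightarrow> op2 \<Rightarrow> op2 \<Rightarrow> bool" where
  "tensor_eq d T T' \<longleftrightarrow> (\<forall>i<d. \<forall>j<d. \<forall>k<d. \<forall>l<d. T i j k l = T' i j k l)"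

lemma act_cong: "tensor_eq d T T' \<Longrightarrow> tensor_eq d (act d w0 w1 w2 w3 T) (act d w0 w1 w2 w3 T')"
  by (simp add: tensor_eq_def act_def site_defs)

lemma act_id:
  assumes "\<And>i j. i < d \<Longrightarrow> j < d \<Longrightarrow> w0 i j = (if i = j then 1 else 0)"
    "\<And>i j. i < d \<Longrightarrow> j < d \<Longrightarrow> w1 i j = (if i = j then 1 else 0)"
    "\<And>i j. i < d \<Longrightarrow> j < d \<Longrightarrow> w2 i j = (if i = j then 1 else 0)"
    "\<And>i j. i < d \<Longrightarrow> j < d \<Longrightarrow> w3 i j = (if i = j then 1 else 0)"
  shows "tensor_eq d (act d w0 w1 w2 w3 T) T"
  using assms
  by (simp add: tensor_eq_def act_def site_defs if_distrib[of "\<lambda>x. x * _"] cong: if_cong)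

text \<open>All four legs are acted on alike, so that one relation serves operators and states; the
  unitaries on the right of an operator are the transposes of those on the last two legs.\<close>

definition lu :: "nat \<Rightarrow> op2 \<Rightarrow> op2 \<Rightarrow> bool" where
  "lu d T T' \<longleftrightarrow> (\<exists>w0 w1 w2 w3. unitary_mat d w0 \<and> unitary_mat d w1 \<and> unitary_mat d w2 \<and> unitary_mat d w3 \<and>
     tensor_eq d T' (act d w0 w1 w2 w3 T))"

lemma luI:
  "unitary_mat d w0 \<Longrightarrow> unitary_mat d w1 \<Longrightarrow> unitary_mat d w2 \<Longrightarrow> unitary_mat d w3 \<Longrightarrow>
    tensor_eq d T' (act d w0 w1 w2 w3 T) \<Longrightarrow> lu d T T'"
  unfolding lu_def by blast

lemma lu_trans:
  assumes "lu d T T'" "lu d T' T''"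
  shows "lu d T T''"
proof -
  obtain w0 w1 w2 w3 where w: "unitary_mat d w0" "unitary_mat d w1" "unitary_mat d w2" "unitary_mat d w3"
    "tensor_eq d T' (act d w0 w1 w2 w3 T)" using assms(1) unfolding lu_def by blast
  obtain u0 u1 u2 u3 where u: "unitary_mat d u0" "unitary_mat d u1" "unitary_mat d u2" "unitary_mat d u3"
    "tensor_eq d T'' (act d u0 u1 u2 u3 T')" using assms(2) unfolding lu_def by blast
  have "tensor_eq d (act d u0 u1 u2 u3 T') (act d u0 u1 u2 u3 (act d w0 w1 w2 w3 T))"
    by (rule act_cong[OF w(5)])
  with u(5) have "tensor_eq d T'' (act d (mmul d u0 w0) (mmul d u1 w1) (mmul d u2 w2) (mmul d u3 w3) T)"
    unfolding act_act by (simp add: tensor_eq_def)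
  then show ?thesis
    by (rule luI[rotated 4]) (intro unitary_mmul u w)+
qed

lemma lu_sym:
  assumes "lu d T T'"
  shows "lu d T' T"
proof -
  obtain w0 w1 w2 w3 where w: "unitary_mat d w0" "unitary_mat d w1" "unitary_mat d w2" "unitary_mat d w3"
    "tensor_eq d T' (act d w0 w1 w2 w3 T)" using assms(1) unfolding lu_def by blast
  let ?A = "act d (dagger w0) (dagger w1) (dagger w2) (dagger w3)"
  have "tensor_eq d (?A T') (?A (act d w0 w1 w2 w3 T))"
    by (rule act_cong[OF w(5)])
  moreover have "tensor_eq d (?A (act d w0 w1 w2 w3 T)) T"
    unfolding act_act using w
    by (intro act_id) (auto simp: mmul_def dagger_def unitary_mat_def)
  ultimately have "tensor_eq d T (?A T')"
    by (simp add: tensor_eq_def)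
  then show ?thesis
    by (rule luI[rotated 4]) (intro unitary_dagger w)+
qed

definition one_mat :: "nat \<Rightarrow> nat \<Rightarrow> complex" where
  "one_mat i j = (if i = j then 1 else 0)"

lemma unitary_one_mat: "unitary_mat d one_mat"
  by (simp add: unitary_mat_def one_mat_def if_distrib[of cnj] if_distrib[of "\<lambda>x. x * _"] cong: if_cong)

section \<open>Local unitaries preserve 2-unitarity\<close>

definition flip_op :: "op2 \<Rightarrow> op2" where "flip_op T = (\<lambda>i j k l. T j i l k)"
definition trans_op :: "op2 \<Rightarrow> op2" where "trans_op T = (\<lambda>i j k l. T k l i j)"

lemma unitary_op2_flip: "unitary_op2 d T \<Longrightarrow> unitary_op2 d (flip_op T)"
  unfolding unitary_op2_def flip_op_def by (subst (1 2) sum.swap) auto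

lemma unitary_op2_trans:
  assumes "unitary_op2 d T"
  shows "unitary_op2 d (trans_op T)"
  using assms by (auto simp: unitary_op2_def trans_op_def mult.commute[of "cnj _"])

lemma sum_swap_pairs:
  "(\<Sum>k\<in>A. \<Sum>c\<in>B. \<Sum>x\<in>C. \<Sum>y\<in>D. f k c x y) = (\<Sum>x\<in>C. \<Sum>y\<in>D. \<Sum>k\<in>A. \<Sum>c\<in>B. (f k c x y :: complex))"
proof -
  have "(\<Sum>p\<in>A\<times>B. \<Sum>q\<in>C\<times>D. f (fst p) (snd p) (fst q) (snd q))
      = (\<Sum>q\<in>C\<times>D. \<Sum>p\<in>A\<times>B. f (fst p) (snd p) (fst q) (snd q))"
    by (rule sum.swap)
  then show ?thesis by (simp add: sum.cartesian_product')
qed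

lemma unitary_op2_site0:
  assumes T: "unitary_op2 d T" and w: "unitary_mat d w"
  shows "unitary_op2 d (site0 d w T)"
proof -
  have "(\<Sum>k<d. \<Sum>c<d. cnj (site0 d w T k c i a) * site0 d w T k c j b) = (if i = j \<and> a = b then 1 else 0)"
    if "i < d" "a < d" "j < d" "b < d" for i a j b
  proof -
    have "(\<Sum>k<d. \<Sum>c<d. cnj (site0 d w T k c i a) * site0 d w T k c j b)
       = (\<Sum>c<d. \<Sum>k<d. cnj (site0 d w T k c i a) * site0 d w T k c j b)"
      by (rule sum.swap)
    also have "\<dots> = (\<Sum>c<d. \<Sum>k<d. cnj (T k c i a) * T k c j b)"
      unfolding site0_def gram_left[OF w] ..
    also have "\<dots> = (\<Sum>k<d. \<Sum>c<d. cnj (T k c i a) * T k c j b)"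
      by (rule sum.swap)
    finally show ?thesis using T that by (simp add: unitary_op2_def)
  qed
  moreover have "(\<Sum>k<d. \<Sum>c<d. site0 d w T i a k c * cnj (site0 d w T j b k c)) = (if i = j \<and> a = b then 1 else 0)"
    if "i < d" "a < d" "j < d" "b < d" for i a j b
  proof -
    have "(\<Sum>k<d. \<Sum>c<d. site0 d w T i a k c * cnj (site0 d w T j b k c))
      = (\<Sum>k<d. \<Sum>c<d. \<Sum>x<d. \<Sum>y<d. (w i x * cnj (w j y)) * (T x a k c * cnj (T y b k c)))"
      unfolding site0_def cnj_sum sum_product by (simp add: algebra_simps)
    also have "\<dots> = (\<Sum>x<d. \<Sum>y<d. (w i x * cnj (w j y)) * (\<Sum>k<d. \<Sum>c<d. T x a k c * cnj (T y b k c)))"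
      unfolding sum_distrib_left
      by (rule sum_swap_pairs)
    also have "\<dots> = (\<Sum>x<d. \<Sum>y<d. (w i x * cnj (w j y) * (if a = b then 1 else 0)) * (if x = y then 1 else 0))"
      using T that by (intro sum.cong refl) (auto simp: unitary_op2_def)
    also have "\<dots> = (\<Sum>x<d. w i x * cnj (w j x)) * (if a = b then 1 else 0)"
      by (simp only: sum_delta_double sum_distrib_right)
    finally show ?thesis using w that by (auto simp: unitary_mat_def)
  qed
  ultimately show ?thesis by (simp add: unitary_op2_def)
qed

text \<open>Exchanging the two factors, and rows with columns, carries the first leg to the three
  others.\<close>

lemma unitary_op2_site:
  assumes T: "unitary_op2 d T" and w: "unitary_mat d w"
  shows "unitary_op2 d (site0 d w T)" "unitary_op2 d (site1 d w T)"
    "unitary_op2 d (site2 d w T)" "unitary_op2 d (site3 d w T)"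
proof -
  show 0: "unitary_op2 d (site0 d w T)" using assms by (rule unitary_op2_site0)
  have eq: "site1 d w T = flip_op (site0 d w (flip_op T))" for T
    by (simp add: site_defs flip_op_def)
  have 1: "unitary_op2 d (site1 d w T)" if "unitary_op2 d T" for T
    unfolding eq using that w by (intro unitary_op2_flip unitary_op2_site0)
  show "unitary_op2 d (site1 d w T)" by (rule 1[OF T])
  have "site2 d w T = trans_op (site0 d w (trans_op T))" "site3 d w T = trans_op (site1 d w (trans_op T))"
    by (simp_all add: site_defs trans_op_def)
  then show "unitary_op2 d (site2 d w T)" "unitary_op2 d (site3 d w T)"
    using T w by (auto intro!: 1 unitary_op2_trans unitary_op2_site0)
qed

text \<open>Counting legs from \<open>0\<close>, \<open>realign\<close> exchanges legs 1 and 2 and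
  \<open>ptrans\<close> exchanges legs 1 and 3, so an action on a leg becomes the same action on its
  image.\<close>

lemma realign_site:
  "realign (site0 d w T) = site0 d w (realign T)" "realign (site1 d w T) = site2 d w (realign T)"
  "realign (site2 d w T) = site1 d w (realign T)" "realign (site3 d w T) = site3 d w (realign T)"
  "ptrans (site0 d w T) = site0 d w (ptrans T)" "ptrans (site1 d w T) = site3 d w (ptrans T)"
  "ptrans (site2 d w T) = site2 d w (ptrans T)" "ptrans (site3 d w T) = site1 d w (ptrans T)"
  by (simp_all add: realign_def ptrans_def site_defs)

declare One_nat_def [simp del]

lemma sum_lessThan_3: "(\<Sum>i<3. f i) = f 0 + f 1 + f (2::nat)"
  by (simp add: eval_nat_numeral One_nat_def)

lemma all_less_3: "(\<forall>i<3. P i) \<longleftrightarrow> P 0 \<and> P 1 \<and> P (2::nat)"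
  by (auto simp: eval_nat_numeral less_Suc_eq One_nat_def)

lemma tensor_eq_site_act:
  "tensor_eq d (site0 d w T) (act d w one_mat one_mat one_mat T)"
  "tensor_eq d (site1 d w T) (act d one_mat w one_mat one_mat T)"
  "tensor_eq d (site2 d w T) (act d one_mat one_mat w one_mat T)"
  "tensor_eq d (site3 d w T) (act d one_mat one_mat one_mat w T)"
  by (simp_all add: tensor_eq_def act_def site_defs one_mat_def if_distrib[of "\<lambda>x. x * _"] cong: if_cong)

lemma lu_site:
  assumes "unitary_mat d w"
  shows "lu d T (site0 d w T)" "lu d T (site1 d w T)" "lu d T (site2 d w T)" "lu d T (site3 d w T)"
  by (rule luI[OF _ _ _ _ tensor_eq_site_act(1)] luI[OF _ _ _ _ tensor_eq_site_act(2)]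
      luI[OF _ _ _ _ tensor_eq_site_act(3)] luI[OF _ _ _ _ tensor_eq_site_act(4)]; intro assms unitary_one_mat)+

lemma two_unitary_site:
  assumes "two_unitary d T" "unitary_mat d w"
  shows "two_unitary d (site0 d w T)" "two_unitary d (site1 d w T)"
    "two_unitary d (site2 d w T)" "two_unitary d (site3 d w T)"
  using assms unfolding two_unitary_def realign_site by (auto intro!: unitary_op2_site)

section \<open>Norms of slices\<close>

lemma unitary_op2_norm:
  assumes "unitary_op2 d T" "i < d" "j < d"
  shows "(\<Sum>k<d. \<Sum>l<d. (cmod (T i j k l))\<^sup>2) = 1" "(\<Sum>k<d. \<Sum>l<d. (cmod (T k l i j))\<^sup>2) = 1"
proof -
  have "complex_of_real (\<Sum>k<d. \<Sum>l<d. (cmod (T i j k l))\<^sup>2) = (\<Sum>k<d. \<Sum>l<d. T i j k l * cnj (T i j k l))"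
    "complex_of_real (\<Sum>k<d. \<Sum>l<d. (cmod (T k l i j))\<^sup>2) = (\<Sum>k<d. \<Sum>l<d. cnj (T k l i j) * T k l i j)"
    by (simp_all only: of_real_sum complex_norm_square mult.commute)
  then have "complex_of_real (\<Sum>k<d. \<Sum>l<d. (cmod (T i j k l))\<^sup>2) = 1"
    "complex_of_real (\<Sum>k<d. \<Sum>l<d. (cmod (T k l i j))\<^sup>2) = 1"
    using assms by (simp_all add: unitary_op2_def)
  then show "(\<Sum>k<d. \<Sum>l<d. (cmod (T i j k l))\<^sup>2) = 1" "(\<Sum>k<d. \<Sum>l<d. (cmod (T k l i j))\<^sup>2) = 1"
    by (simp_all only: of_real_eq_1_iff)
qed

text \<open>These are the rows and columns of the three rearrangements; together they fix each of
  the six pairs of legs once.\<close>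

lemma two_unitary_norm:
  assumes "two_unitary d T" "i < d" "j < d"
  shows "(\<Sum>k<d. \<Sum>l<d. (cmod (T i j k l))\<^sup>2) = 1"
    "(\<Sum>k<d. \<Sum>l<d. (cmod (T i k j l))\<^sup>2) = 1"
    "(\<Sum>k<d. \<Sum>l<d. (cmod (T i l k j))\<^sup>2) = 1"
    "(\<Sum>k<d. \<Sum>l<d. (cmod (T k j i l))\<^sup>2) = 1"
    "(\<Sum>k<d. \<Sum>l<d. (cmod (T k i l j))\<^sup>2) = 1"
    "(\<Sum>k<d. \<Sum>l<d. (cmod (T k l i j))\<^sup>2) = 1"
  using assms(1) unitary_op2_norm[of d T i j] unitary_op2_norm[of d "realign T" i j]
    unitary_op2_norm[of d "ptrans T" i j] assms(2,3)
  by (simp_all add: two_unitary_def realign_def ptrans_def)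

lemma double_sum_one_other_zero:
  fixes f :: "nat \<Rightarrow> nat \<Rightarrow> real"
  assumes "(\<Sum>k<d. \<Sum>l<d. f k l) = 1" "\<And>k l. 0 \<le> f k l" "f k l = 1"
    "k < d" "l < d" "k' < d" "l' < d" "(k', l') \<noteq> (k, l)"
  shows "f k' l' = 0"
proof -
  have "f k l + f k' l' = (\<Sum>p\<in>{(k,l),(k',l')}. f (fst p) (snd p))"
    using assms(8) by (subst sum.insert) auto
  also have "\<dots> \<le> (\<Sum>p\<in>{..<d}\<times>{..<d}. f (fst p) (snd p))"
    using assms by (intro sum_mono2) auto
  also have "\<dots> = 1" using assms(1) by (simp add: sum.cartesian_product')
  finally show ?thesis using assms(2)[of k' l'] assms(3) by simp
qed

text \<open>An entry of modulus one exhausts the norm of each of its six slices.\<close>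

lemma isolated:
  assumes T: "two_unitary d T" and one: "cmod (T i j k l) = 1" and "i < d" "j < d" "k < d" "l < d"
    "i' < d" "j' < d" "k' < d" "l' < d" "(i', j', k', l') \<noteq> (i, j, k, l)"
    "i' = i \<and> j' = j \<or> i' = i \<and> k' = k \<or> i' = i \<and> l' = l \<or> j' = j \<and> k' = k \<or> j' = j \<and> l' = l \<or> k' = k \<and> l' = l"
  shows "T i' j' k' l' = 0"
proof -
  note Z = double_sum_one_other_zero[of _ d, OF _ zero_le_power2]
  have one': "(cmod (T i j k l))\<^sup>2 = 1" using one by simp
  from assms(12) have "(cmod (T i' j' k' l'))\<^sup>2 = 0"
  proof (elim disjE conjE)
    assume "i' = i" "j' = j" then show ?thesis
      using Z[OF two_unitary_norm(1)[OF T \<open>i < d\<close> \<open>j < d\<close>] one', of k' l'] assms by auto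
  next
    assume "i' = i" "k' = k" then show ?thesis
      using Z[OF two_unitary_norm(2)[OF T \<open>i < d\<close> \<open>k < d\<close>] one', of j' l'] assms by auto
  next
    assume "i' = i" "l' = l" then show ?thesis
      using Z[OF two_unitary_norm(3)[OF T \<open>i < d\<close> \<open>l < d\<close>] one', of k' j'] assms by auto
  next
    assume "j' = j" "k' = k" then show ?thesis
      using Z[OF two_unitary_norm(4)[OF T \<open>k < d\<close> \<open>j < d\<close>] one', of i' l'] assms by auto
  next
    assume "j' = j" "l' = l" then show ?thesis
      using Z[OF two_unitary_norm(5)[OF T \<open>j < d\<close> \<open>l < d\<close>] one', of i' k'] assms by auto
  next
    assume "k' = k" "l' = l" then show ?thesis
      using Z[OF two_unitary_norm(6)[OF T \<open>k < d\<close> \<open>l < d\<close>] one', of i' j'] assms by auto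
  qed
  then show ?thesis by simp
qed

subsection \<open>Normal form\<close>

text \<open>The block on the indices \<open>1\<close>, \<open>2\<close> has rows
  \<open>(p, q)\<close> and \<open>(- cnj q, cnj p)\<close>. Index \<open>0\<close> is fixed so that
  entries normalised earlier survive.\<close>

lemma unitary_with_block_row:
  assumes "(cmod p)\<^sup>2 + (cmod q)\<^sup>2 = 1"
  shows "\<exists>W. unitary_mat 3 W \<and> W 0 0 = 1 \<and> W 0 1 = 0 \<and> W 0 2 = 0 \<and> W 1 0 = 0 \<and> W 1 1 = p \<and> W 1 2 = q"
proof -
  define W where "W = (\<lambda>i j. if i = (0::nat) \<or> j = (0::nat) then if i = j then 1 else 0
    else if i = 1 then if j = 1 then p else q else if j = 1 then - cnj q else cnj p)"
  have *: "p * cnj p + q * cnj q = 1"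
    using arg_cong[OF assms, of complex_of_real] by (simp add: complex_norm_square[symmetric])
  have "unitary_mat 3 W"
    using * unfolding unitary_mat_def all_less_3 sum_lessThan_3 by (simp add: W_def algebra_simps)
  then show ?thesis
    by (intro exI[of _ W]) (simp add: W_def)
qed

text \<open>A product of two planar unitaries: \<open>R\<close> has first row
  \<open>(u 0, r, 0)\<close>, and \<open>V\<close> splits \<open>r\<close> into \<open>u 1\<close>
  and \<open>u 2\<close>.\<close>

lemma unitary_with_row:
  assumes "(\<Sum>i<3. (cmod (u i))\<^sup>2) = 1"
  shows "\<exists>W. unitary_mat 3 W \<and> (\<forall>i<3. W 0 i = u i)"
proof -
  define r where "r = sqrt ((cmod (u 1))\<^sup>2 + (cmod (u 2))\<^sup>2)"
  have r: "r\<^sup>2 = (cmod (u 1))\<^sup>2 + (cmod (u 2))\<^sup>2" "0 \<le> r" by (auto simp: r_def)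
  have "\<exists>p q. (cmod p)\<^sup>2 + (cmod q)\<^sup>2 = 1 \<and> u 1 = of_real r * p \<and> u 2 = of_real r * q"
  proof (cases "r = 0")
    case True
    then show ?thesis using r by (intro exI[of _ 1] exI[of _ 0]) (auto simp: sum_power2_eq_zero_iff)
  next
    case False
    then have "(cmod (u 1))\<^sup>2 / r\<^sup>2 + (cmod (u 2))\<^sup>2 / r\<^sup>2 = 1"
      by (simp only: add_divide_distrib[symmetric] r(1)[symmetric]) simp
    then show ?thesis
      using False by (intro exI[of _ "u 1 / of_real r"] exI[of _ "u 2 / of_real r"])
        (simp add: norm_divide power_divide)
  qed
  then obtain p q where pq: "(cmod p)\<^sup>2 + (cmod q)\<^sup>2 = 1" "u 1 = of_real r * p" "u 2 = of_real r * q" by blast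
  obtain V where V: "unitary_mat 3 V" "V 0 0 = 1" "V 0 1 = 0" "V 0 2 = 0" "V 1 0 = 0" "V 1 1 = p" "V 1 2 = q"
    using unitary_with_block_row[OF pq(1)] by blast
  define R where "R = (\<lambda>i j. if i = (2::nat) \<or> j = (2::nat) then if i = j then 1 else 0
    else if i = 0 then if j = (0::nat) then u 0 else of_real r else if j = 0 then - of_real r else cnj (u 0))"
  have "(cmod (u 0))\<^sup>2 + r\<^sup>2 = 1" using assms r(1) by (simp add: sum_lessThan_3)
  from arg_cong[OF this, of complex_of_real] have *: "u 0 * cnj (u 0) + of_real r * of_real r = 1"
    by (simp add: complex_norm_square[symmetric] power2_eq_square[symmetric])
  have "unitary_mat 3 R"
    using * unfolding unitary_mat_def all_less_3 sum_lessThan_3 by (simp add: R_def algebra_simps)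
  then have "unitary_mat 3 (mmul 3 R V)"
    using V(1) by (rule unitary_mmul)
  moreover have "\<forall>i<3. mmul 3 R V 0 i = u i"
    unfolding all_less_3 by (simp add: mmul_def sum_lessThan_3 R_def V pq(2,3))
  ultimately show ?thesis by blast
qed

text \<open>The functionals are the normalised conjugates of \<open>c\<close> and \<open>d\<close>.
  On \<open>M\<close> they give the product of the norms of \<open>c\<close> and \<open>d\<close>,
  which is the norm of \<open>M\<close>, hence \<open>1\<close>.\<close>

lemma rank_one_functional:
  fixes M :: "nat \<Rightarrow> nat \<Rightarrow> complex"
  assumes M: "\<And>k l. k \<in> A \<Longrightarrow> l \<in> A \<Longrightarrow> M k l = c k * d l"
    and norm: "(\<Sum>k\<in>A. \<Sum>l\<in>A. (cmod (M k l))\<^sup>2) = 1"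
  shows "\<exists>u v. (\<Sum>k\<in>A. (cmod (u k))\<^sup>2) = 1 \<and> (\<Sum>l\<in>A. (cmod (v l))\<^sup>2) = 1 \<and>
    (\<Sum>k\<in>A. u k * (\<Sum>l\<in>A. v l * M k l)) = 1"
proof -
  define n where "n = (\<lambda>x. sqrt (\<Sum>k\<in>A. (cmod (x k))\<^sup>2))"
  have n: "(n x)\<^sup>2 = (\<Sum>k\<in>A. (cmod (x k))\<^sup>2)" "0 \<le> n x" for x
    by (simp_all add: n_def sum_nonneg)
  have "(\<Sum>k\<in>A. \<Sum>l\<in>A. (cmod (M k l))\<^sup>2) = (\<Sum>k\<in>A. (cmod (c k))\<^sup>2) * (\<Sum>l\<in>A. (cmod (d l))\<^sup>2)"
    by (simp add: M norm_mult power_mult_distrib sum_product)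
  then have "(n c * n d)\<^sup>2 = 1" using norm by (simp add: n power_mult_distrib)
  moreover have "0 \<le> n c * n d" using n by simp
  ultimately have cd: "n c * n d = 1"
    by (metis abs_of_nonneg abs_1 power2_eq_1_iff abs_minus_cancel)
  then have nz: "n c \<noteq> 0" "n d \<noteq> 0" by auto
  have unit: "(\<Sum>k\<in>A. (cmod (cnj (x k) / of_real (n x)))\<^sup>2) = 1" if "n x \<noteq> 0" for x
    using that by (simp add: norm_divide power_divide sum_divide_distrib[symmetric] n(1)[symmetric])
  have inner: "(\<Sum>k\<in>A. cnj (x k) / of_real (n x) * x k) = of_real (n x)" if "n x \<noteq> 0" for x
  proof -
    have "(\<Sum>k\<in>A. cnj (x k) / of_real (n x) * x k) = of_real (\<Sum>k\<in>A. (cmod (x k))\<^sup>2) / of_real (n x)"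
      by (simp add: sum_divide_distrib complex_norm_square[symmetric] mult.commute)
    also have "\<dots> = of_real (n x)"
      unfolding n(1)[symmetric] using that by (simp add: power2_eq_square)
    finally show ?thesis .
  qed
  have "(\<Sum>k\<in>A. cnj (c k) / of_real (n c) * (\<Sum>l\<in>A. cnj (d l) / of_real (n d) * M k l))
     = (\<Sum>k\<in>A. cnj (c k) / of_real (n c) * (c k * (\<Sum>l\<in>A. cnj (d l) / of_real (n d) * d l)))"
    using M by (intro sum.cong refl arg_cong2[of _ _ _ _ "(*)"]) (auto simp: sum_distrib_left mult_ac intro!: sum.cong)
  also have "\<dots> = (\<Sum>k\<in>A. cnj (c k) / of_real (n c) * c k) * (\<Sum>l\<in>A. cnj (d l) / of_real (n d) * d l)"
    by (simp add: sum_distrib_right mult.assoc)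
  also have "\<dots> = of_real (n c * n d)"
    using inner nz by simp
  finally have "(\<Sum>k\<in>A. cnj (c k) / of_real (n c) * (\<Sum>l\<in>A. cnj (d l) / of_real (n d) * M k l)) = 1"
    using cd by simp
  then show ?thesis
    using unit nz by (intro exI conjI) (assumption | rule unit)+
qed

section \<open>Normalising one entry after another\<close>

text \<open>Unitaries whose first rows are the normalised \<open>a\<close> and \<open>b\<close> make
  the slice \<open>T1 0 0\<close> a rank-one matrix of norm one; unitaries on the last two legs then
  concentrate it in a single entry.\<close>

lemma lu_normalize_0000:
  assumes T: "two_unitary 3 T"
  shows "\<exists>T'. lu 3 T T' \<and> two_unitary 3 T' \<and> T' 0 0 0 0 = 1"
proof -
  obtain a b c d where ab: "\<exists>i<3. \<exists>j<3. a i * b j \<noteq> 0"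
    and cd: "\<And>k l. k < 3 \<Longrightarrow> l < 3 \<Longrightarrow> (\<Sum>i<3. \<Sum>j<3. T i j k l * a i * b j) = c k * d l"
    using product_to_product[of T] by blast
  define n where "n = (\<lambda>x :: nat \<Rightarrow> complex. sqrt (\<Sum>k<3. (cmod (x k))\<^sup>2))"
  have n_pos: "0 < n x" if "i < 3" "x i \<noteq> 0" for x i
    unfolding n_def using that by (intro real_sqrt_gt_zero sum_pos2[of _ i]) auto
  have na: "n a \<noteq> 0" "n b \<noteq> 0" using ab n_pos by (metis less_irrefl mult_eq_0_iff)+
  have unit: "(\<Sum>k<3. (cmod (x k / of_real (n x)))\<^sup>2) = 1" if "n x \<noteq> 0" for x
  proof -
    have eq: "(n x)\<^sup>2 = (\<Sum>k<3. (cmod (x k))\<^sup>2)" by (simp add: n_def sum_nonneg)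
    show ?thesis
      using that by (simp add: norm_divide power_divide sum_divide_distrib[symmetric] eq[symmetric])
  qed
  obtain W0 where W0: "unitary_mat 3 W0" "\<And>i. i < 3 \<Longrightarrow> W0 0 i = a i / of_real (n a)"
    using unitary_with_row[OF unit[OF na(1)]] by blast
  obtain W1 where W1: "unitary_mat 3 W1" "\<And>i. i < 3 \<Longrightarrow> W1 0 i = b i / of_real (n b)"
    using unitary_with_row[OF unit[OF na(2)]] by blast
  define T1 where "T1 = site0 3 W0 (site1 3 W1 T)"
  have T1: "lu 3 T T1" "two_unitary 3 T1"
    unfolding T1_def
    by (rule lu_trans[OF lu_site(2)[OF W1(1)] lu_site(1)[OF W0(1)]]
        two_unitary_site(1)[OF two_unitary_site(2)[OF T W1(1)] W0(1)])+
  have "T1 0 0 k l = (c k / of_real (n a * n b)) * d l" if "k < 3" "l < 3" for k l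
  proof -
    have "T1 0 0 k l = (\<Sum>i<3. \<Sum>j<3. T i j k l * a i * b j) / of_real (n a * n b)"
      by (simp add: T1_def site_defs W0 W1 sum_divide_distrib sum_distrib_left mult_ac)
    then show ?thesis using cd[OF that] by simp
  qed
  then obtain u v where uv: "(\<Sum>k<3. (cmod (u k))\<^sup>2) = 1" "(\<Sum>l<3. (cmod (v l))\<^sup>2) = 1"
    "(\<Sum>k<3. u k * (\<Sum>l<3. v l * T1 0 0 k l)) = 1"
    using rank_one_functional[of "{..<3}" "T1 0 0" "\<lambda>k. c k / of_real (n a * n b)" d]
      two_unitary_norm(1)[OF T1(2), of 0 0] by auto
  obtain W2 where W2: "unitary_mat 3 W2" "\<And>i. i < 3 \<Longrightarrow> W2 0 i = u i"
    using unitary_with_row[OF uv(1)] by blast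
  obtain W3 where W3: "unitary_mat 3 W3" "\<And>i. i < 3 \<Longrightarrow> W3 0 i = v i"
    using unitary_with_row[OF uv(2)] by blast
  define T2 where "T2 = site2 3 W2 (site3 3 W3 T1)"
  have "lu 3 T T2" "two_unitary 3 T2"
    unfolding T2_def
    by (rule lu_trans[OF T1(1) lu_trans[OF lu_site(4)[OF W3(1)] lu_site(3)[OF W2(1)]]]
        two_unitary_site(3)[OF two_unitary_site(4)[OF T1(2) W3(1)] W2(1)])+
  moreover have "T2 0 0 0 0 = 1"
    using uv(3) by (simp add: T2_def site_defs W2 W3)
  ultimately show ?thesis by blast
qed

text \<open>A root \<open>z\<close> of the quadratic gives the zero \<open>(z, 1)\<close>, which is
  then normalised; for vanishing \<open>\<alpha>\<close> the vector \<open>(1, 0)\<close> is a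
  zero.\<close>

lemma exists_null_combination:
  fixes \<alpha> \<beta> \<gamma> :: complex
  shows "\<exists>s t. (cmod s)\<^sup>2 + (cmod t)\<^sup>2 = 1 \<and> \<alpha> * s\<^sup>2 + \<beta> * s * t + \<gamma> * t\<^sup>2 = 0"
proof (cases "\<alpha> = 0")
  case True
  then show ?thesis by (intro exI[of _ 1] exI[of _ 0]) auto
next
  case False
  define z where "z = (csqrt (\<beta>\<^sup>2 - 4 * \<alpha> * \<gamma>) - \<beta>) / (2 * \<alpha>)"
  have "(2 * \<alpha> * z + \<beta>)\<^sup>2 = \<beta>\<^sup>2 - 4 * \<alpha> * \<gamma>"
    using False by (simp add: z_def)
  then have "4 * \<alpha> * (\<alpha> * z\<^sup>2 + \<beta> * z + \<gamma>) = 0"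
    by (simp add: power2_eq_square algebra_simps)
  then have z: "\<alpha> * z\<^sup>2 + \<beta> * z + \<gamma> = 0" using False by simp
  define r where "r = sqrt ((cmod z)\<^sup>2 + 1)"
  have r: "r\<^sup>2 = (cmod z)\<^sup>2 + 1" "0 < r"
    by (auto simp: r_def add_nonneg_pos)
  show ?thesis
  proof (intro exI conjI)
    show "(cmod (z / of_real r))\<^sup>2 + (cmod (1 / of_real r))\<^sup>2 = 1"
    proof -
      have "(cmod z)\<^sup>2 / r\<^sup>2 + 1 / r\<^sup>2 = 1"
        using r(2) by (simp only: add_divide_distrib[symmetric] r(1)[symmetric]) simp
      then show ?thesis using r(2) by (simp add: norm_divide power_divide)
    qed
    have "\<alpha> * (z / of_real r)\<^sup>2 + \<beta> * (z / of_real r) * (1 / of_real r) + \<gamma> * (1 / of_real r)\<^sup>2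
       = (\<alpha> * z\<^sup>2 + \<beta> * z + \<gamma>) / (of_real r)\<^sup>2"
      using r by (simp add: power2_eq_square add_divide_distrib)
    then show "\<alpha> * (z / of_real r)\<^sup>2 + \<beta> * (z / of_real r) * (1 / of_real r) + \<gamma> * (1 / of_real r)\<^sup>2 = 0"
      using z by simp
  qed
qed

text \<open>A rotation of the second leg makes the block of \<open>T 0 1\<close> on the indices
  \<open>1\<close>, \<open>2\<close> singular, hence of rank one, and rotations of the last two legs
  concentrate it in one entry. All of them fix index \<open>0\<close>.\<close>

lemma lu_normalize_0111:
  assumes T: "two_unitary 3 T" "T 0 0 0 0 = 1"
  shows "\<exists>T'. lu 3 T T' \<and> two_unitary 3 T' \<and> T' 0 0 0 0 = 1 \<and> T' 0 1 1 1 = 1"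
proof -
  \<comment> \<open>The quadratic form is the determinant of \<open>s * T 0 1 + t * T 0 2\<close>
    restricted to the indices \<open>1\<close> and \<open>2\<close>.\<close>
  obtain s t where st: "(cmod s)\<^sup>2 + (cmod t)\<^sup>2 = 1"
    "(T 0 1 1 1 * T 0 1 2 2 - T 0 1 1 2 * T 0 1 2 1) * s\<^sup>2
      + (T 0 1 1 1 * T 0 2 2 2 + T 0 2 1 1 * T 0 1 2 2 - T 0 1 1 2 * T 0 2 2 1 - T 0 2 1 2 * T 0 1 2 1) * s * t
      + (T 0 2 1 1 * T 0 2 2 2 - T 0 2 1 2 * T 0 2 2 1) * t\<^sup>2 = 0"
    using exists_null_combination by blast
  obtain W1 where W1: "unitary_mat 3 W1" "W1 0 0 = 1" "W1 0 1 = 0" "W1 0 2 = 0" "W1 1 0 = 0" "W1 1 1 = s" "W1 1 2 = t"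
    using unitary_with_block_row[OF st(1)] by blast
  define T1 where "T1 = site1 3 W1 T"
  have T1: "lu 3 T T1" "two_unitary 3 T1"
    unfolding T1_def by (rule lu_site(2)[OF W1(1)] two_unitary_site(2)[OF T(1) W1(1)])+
  have T1_eq: "T1 0 0 k l = T 0 0 k l" "T1 0 1 k l = s * T 0 1 k l + t * T 0 2 k l" for k l
    by (simp_all add: T1_def site_defs sum_lessThan_3 W1)
  have det: "T1 0 1 1 1 * T1 0 1 2 2 = T1 0 1 1 2 * T1 0 1 2 1"
    using st(2) unfolding T1_eq by (simp add: algebra_simps power2_eq_square)
  have "\<exists>c d. \<forall>k<2. \<forall>l<2. T1 0 1 (Suc k) (Suc l) = c k * d l"
    using det by (intro rank_one_factor) (auto simp: less_Suc_eq numeral_2_eq_2 One_nat_def mult.commute)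
  then obtain c d where cd: "\<And>k l. k < 2 \<Longrightarrow> l < 2 \<Longrightarrow> T1 0 1 (Suc k) (Suc l) = c k * d l" by blast
  have cd': "T1 0 1 k l = c (k - 1) * d (l - 1)" if "k \<in> {1, 2}" "l \<in> {1, 2}" for k l
    using that cd[of "k - 1" "l - 1"] by (auto simp: numeral_2_eq_2 One_nat_def)
  \<comment> \<open>The entry at \<open>0000\<close> kills the rest of the slice
    \<open>T1 0 1\<close>, so the block carries the whole norm.\<close>
  have "T1 0 1 k l = 0" if "k < 3" "l < 3" "k = 0 \<or> l = 0" for k l
    using that T(2) by (intro isolated[OF T1(2), of 0 0 0 0]) (auto simp: T1_eq)
  then have "(\<Sum>k\<in>{1,2}. \<Sum>l\<in>{1,2}. (cmod (T1 0 1 k l))\<^sup>2) = 1"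
    using two_unitary_norm(1)[OF T1(2), of 0 1] by (simp add: sum_lessThan_3)
  then obtain u v where uv: "(\<Sum>k\<in>{1,2}. (cmod (u k))\<^sup>2) = 1" "(\<Sum>l\<in>{1,2}. (cmod (v l))\<^sup>2) = 1"
    "(\<Sum>k\<in>{1,2}. u k * (\<Sum>l\<in>{1,2}. v l * T1 0 1 k l)) = 1"
    using rank_one_functional[of "{1,2}" "T1 0 1" "\<lambda>k. c (k - 1)" "\<lambda>l. d (l - 1)"] cd' by blast
  obtain W2 where W2: "unitary_mat 3 W2" "W2 0 0 = 1" "W2 0 1 = 0" "W2 0 2 = 0" "W2 1 0 = 0" "W2 1 1 = u 1" "W2 1 2 = u 2"
    using unitary_with_block_row[of "u 1" "u 2"] uv(1) by auto
  obtain W3 where W3: "unitary_mat 3 W3" "W3 0 0 = 1" "W3 0 1 = 0" "W3 0 2 = 0" "W3 1 0 = 0" "W3 1 1 = v 1" "W3 1 2 = v 2"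
    using unitary_with_block_row[of "v 1" "v 2"] uv(2) by auto
  define T2 where "T2 = site2 3 W2 (site3 3 W3 T1)"
  have "lu 3 T T2" "two_unitary 3 T2"
    unfolding T2_def
    by (rule lu_trans[OF T1(1) lu_trans[OF lu_site(4)[OF W3(1)] lu_site(3)[OF W2(1)]]]
        two_unitary_site(3)[OF two_unitary_site(4)[OF T1(2) W3(1)] W2(1)])+
  moreover have "T2 0 0 0 0 = 1"
    using T(2) by (simp add: T2_def site_defs sum_lessThan_3 W2 W3 T1_eq)
  moreover have "T2 0 1 1 1 = 1"
    using uv(3) by (simp add: T2_def site_defs sum_lessThan_3 W2 W3)
  ultimately show ?thesis by blast
qed

text \<open>The tetracode: linear of dimension two and distance three, so that a word is determined by
  any two of its entries.\<close>

definition tetra :: "nat \<Rightarrow> nat \<Rightarrow> nat \<Rightarrow> nat \<Rightarrow> bool" where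
  "tetra i j k l \<longleftrightarrow> k = (i + j) mod 3 \<and> l = (2 * i + j) mod 3"

definition tetra_op :: op2 where
  "tetra_op i j k l = (if tetra i j k l then 1 else 0)"

text \<open>Of the entries with second index \<open>0\<close> and third index \<open>1\<close>, the
  words \<open>0000\<close> and \<open>0111\<close> leave only \<open>T 1 0 1 2\<close> and
  \<open>T 2 0 1 2\<close>. A rotation of the first leg that fixes index \<open>0\<close> merges
  these two.\<close>

lemma lu_normalize_1012:
  assumes T: "two_unitary 3 T" "T 0 0 0 0 = 1" "T 0 1 1 1 = 1"
  shows "\<exists>T'. lu 3 T T' \<and> two_unitary 3 T' \<and> T' 0 0 0 0 = 1 \<and> T' 0 1 1 1 = 1 \<and> T' 1 0 1 2 = 1"
proof -
  have z0: "T i j k l = 0" if "i < 3" "j < 3" "k < 3" "l < 3" "(i, j, k, l) \<noteq> (0, 0, 0, 0)"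
      "i = 0 \<and> j = 0 \<or> i = 0 \<and> k = 0 \<or> i = 0 \<and> l = 0 \<or> j = 0 \<and> k = 0 \<or> j = 0 \<and> l = 0 \<or> k = 0 \<and> l = 0" for i j k l
    using that T(2) by (intro isolated[OF T(1), of 0 0 0 0]) auto
  have z1: "T i j k l = 0" if "i < 3" "j < 3" "k < 3" "l < 3" "(i, j, k, l) \<noteq> (0, 1, 1, 1)"
      "i = 0 \<and> j = 1 \<or> i = 0 \<and> k = 1 \<or> i = 0 \<and> l = 1 \<or> j = 1 \<and> k = 1 \<or> j = 1 \<and> l = 1 \<or> k = 1 \<and> l = 1" for i j k l
    using that T(3) by (intro isolated[OF T(1), of 0 1 1 1]) auto
  have "(cmod (T 1 0 1 2))\<^sup>2 + (cmod (T 2 0 1 2))\<^sup>2 = 1"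
    using two_unitary_norm(4)[OF T(1), of 1 0] by (simp add: sum_lessThan_3 z0 z1)
  then have "(cmod (cnj (T 1 0 1 2)))\<^sup>2 + (cmod (cnj (T 2 0 1 2)))\<^sup>2 = 1" by simp
  from unitary_with_block_row[OF this] obtain W where W: "unitary_mat 3 W" "W 0 0 = 1" "W 0 1 = 0" "W 0 2 = 0"
    "W 1 0 = 0" "W 1 1 = cnj (T 1 0 1 2)" "W 1 2 = cnj (T 2 0 1 2)" by blast
  have "complex_of_real ((cmod (T 1 0 1 2))\<^sup>2 + (cmod (T 2 0 1 2))\<^sup>2) = 1"
    using \<open>(cmod (T 1 0 1 2))\<^sup>2 + (cmod (T 2 0 1 2))\<^sup>2 = 1\<close> by (simp only: of_real_1)
  then have "cnj (T 1 0 1 2) * T 1 0 1 2 + cnj (T 2 0 1 2) * T 2 0 1 2 = 1"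
    by (simp only: of_real_add complex_norm_square mult.commute)
  then have "site0 3 W T 1 0 1 2 = 1" "site0 3 W T 0 0 0 0 = 1" "site0 3 W T 0 1 1 1 = 1"
    using T by (simp_all add: site_defs sum_lessThan_3 W)
  then show ?thesis
    using lu_site(1)[OF W(1)] two_unitary_site(1)[OF T(1) W(1)] by blast
qed

section \<open>Support on the tetracode and removal of phases\<close>

text \<open>In six slices, taken in turn, the entries known so far kill all but one position, which
  therefore has modulus one. This reaches all nine code words, and any other word shares its first
  two letters with a code word.\<close>

lemma tetra_support:
  assumes T: "two_unitary 3 T" "T 0 0 0 0 = 1" "T 0 1 1 1 = 1" "T 1 0 1 2 = 1"
    and lt: "i < 3" "j < 3" "k < 3" "l < 3"
  shows "cmod (T i j k l) = (if tetra i j k l then 1 else 0)"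
proof -
  have iso: "\<forall>i'<3. \<forall>j'<3. \<forall>k'<3. \<forall>l'<3. (i', j', k', l') \<noteq> (i, j, k, l) \<longrightarrow>
      (i' = i \<and> j' = j \<or> i' = i \<and> k' = k \<or> i' = i \<and> l' = l \<or> j' = j \<and> k' = k \<or> j' = j \<and> l' = l \<or> k' = k \<and> l' = l)
      \<longrightarrow> T i' j' k' l' = 0"
    if "cmod (T i j k l) = 1" "i < 3" "j < 3" "k < 3" "l < 3" for i j k l
    using isolated[OF T(1) that] by blast
  note norm = two_unitary_norm[OF T(1)]
  note z0 = iso[of 0 0 0 0, unfolded all_less_3, simplified] and z1 = iso[of 0 1 1 1, unfolded all_less_3, simplified]
    and z2 = iso[of 0 2 2 2, unfolded all_less_3, simplified] and z3 = iso[of 1 0 1 2, unfolded all_less_3, simplified]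
    and z4 = iso[of 2 0 2 1, unfolded all_less_3, simplified]
  have sq: "cmod x = 1" if "(cmod x)\<^sup>2 = 1" for x :: complex
    using that by (metis norm_ge_zero abs_of_nonneg power2_eq_1_iff abs_1 abs_minus_cancel)
  have c0222: "cmod (T 0 2 2 2) = 1"
    using norm(1)[of 0 2] T by (intro sq) (simp add: sum_lessThan_3 z0 z1)
  have c2021: "cmod (T 2 0 2 1) = 1"
    using norm(4)[of 2 0] T c0222 by (intro sq) (simp add: sum_lessThan_3 z0 z1 z2 z3)
  have c2102: "cmod (T 2 1 0 2) = 1"
    using norm(4)[of 0 1] T c0222 by (intro sq) (simp add: sum_lessThan_3 z0 z1 z2 z3)
  have c2210: "cmod (T 2 2 1 0) = 1"
    using norm(4)[of 1 2] T c0222 by (intro sq) (simp add: sum_lessThan_3 z0 z1 z2 z3)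
  have c1120: "cmod (T 1 1 2 0) = 1"
    using norm(4)[of 2 1] T c0222 c2021 by (intro sq) (simp add: sum_lessThan_3 z0 z1 z2 z4)
  have c1201: "cmod (T 1 2 0 1) = 1"
    using norm(4)[of 0 2] T c0222 c2021 by (intro sq) (simp add: sum_lessThan_3 z0 z1 z2 z4)
  have "\<forall>i<3. \<forall>j<3. cmod (T i j ((i + j) mod 3) ((2 * i + j) mod 3)) = 1"
    using T(2-4) c0222 c2021 c2102 c2210 c1120 c1201 unfolding all_less_3
    by (simp add: One_nat_def[symmetric])
  then have one: "cmod (T i j ((i + j) mod 3) ((2 * i + j) mod 3)) = 1" using lt by blast
  show ?thesis
  proof (cases "tetra i j k l")
    case True
    then show ?thesis using one by (simp add: tetra_def)
  next
    case False
    have "T i j k l = 0"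
      using False lt by (intro isolated[OF T(1) one]) (auto simp: tetra_def)
    then show ?thesis using False by simp
  qed
qed

lemma unitary_diag_cis: "unitary_mat d (\<lambda>i j. if i = j then cis (f i) else 0)"
  by (simp add: unitary_mat_def if_distrib[of cnj] if_distrib[of "\<lambda>x. x * _"] cis_cnj cis_mult cong: if_cong)

text \<open>Every point of the affine plane over \<open>GF(3)\<close> lies on four lines which together cover it four
  times and every other point once. Hence a function on the plane is a third of the sum of its four
  line sums, minus a third of its total.\<close>

lemma plane_from_line_sums:
  fixes \<theta> :: "nat \<Rightarrow> nat \<Rightarrow> real"
  shows "\<exists>\<alpha> \<beta> \<gamma> \<delta>. \<forall>i<3. \<forall>j<3. \<theta> i j = \<alpha> i + \<beta> j + \<gamma> ((i + j) mod 3) + \<delta> ((2 * i + j) mod 3)"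
proof -
  define total where "total = (\<Sum>i<3. \<Sum>j<3. \<theta> i j)"
  show ?thesis
    by (rule exI[of _ "\<lambda>i. (\<Sum>j<3. \<theta> i j) / 3 - total / 3"], rule exI[of _ "\<lambda>j. (\<Sum>i<3. \<theta> i j) / 3"],
        rule exI[of _ "\<lambda>k. (\<Sum>i<3. \<theta> i ((k + 2 * i) mod 3)) / 3"],
        rule exI[of _ "\<lambda>l. (\<Sum>i<3. \<theta> i ((l + i) mod 3)) / 3"])
      (simp add: all_less_3 sum_lessThan_3 total_def field_simps One_nat_def[symmetric])
qed

text \<open>The phases form a function of \<open>(i, j)\<close>. Written as a sum of four functions
  of one leg each, it is cancelled by a diagonal unitary on every leg.\<close>

lemma lu_tetra_of_support:
  assumes supp: "\<And>i j k l. i < 3 \<Longrightarrow> j < 3 \<Longrightarrow> k < 3 \<Longrightarrow> l < 3 \<Longrightarrow>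
      cmod (T i j k l) = (if tetra i j k l then 1 else 0)"
  shows "lu 3 T tetra_op"
proof -
  define \<theta> where "\<theta> = (\<lambda>i j. Arg (T i j ((i + j) mod 3) ((2 * i + j) mod 3)))"
  obtain \<alpha> \<beta> \<gamma> \<delta> where \<theta>: "\<And>i j. i < 3 \<Longrightarrow> j < 3 \<Longrightarrow>
      \<theta> i j = \<alpha> i + \<beta> j + \<gamma> ((i + j) mod 3) + \<delta> ((2 * i + j) mod 3)"
    using plane_from_line_sums[of \<theta>] by blast
  define D where "D = (\<lambda>f i j. if i = (j::nat) then cis (- f i) else 0)"
  have "tensor_eq 3 tetra_op (act 3 (D \<alpha>) (D \<beta>) (D \<gamma>) (D \<delta>) T)"
    unfolding tensor_eq_def
  proof (intro allI impI)
    fix i j k l :: nat assume lt: "i < 3" "j < 3" "k < 3" "l < 3"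
    have act: "act 3 (D \<alpha>) (D \<beta>) (D \<gamma>) (D \<delta>) T i j k l
        = cis (- \<alpha> i) * (cis (- \<beta> j) * (cis (- \<gamma> k) * (cis (- \<delta> l) * T i j k l)))"
      using lt by (simp add: act_def site_defs D_def if_distrib[of "\<lambda>x. x * _"] cong: if_cong)
    show "tetra_op i j k l = act 3 (D \<alpha>) (D \<beta>) (D \<gamma>) (D \<delta>) T i j k l"
    proof (cases "tetra i j k l")
      case True
      then have "cmod (T i j k l) = 1" using supp[OF lt] by simp
      moreover from this have "T i j k l \<noteq> 0" by auto
      ultimately have "T i j k l = cis (\<theta> i j)"
        using True cis_Arg[of "T i j k l"] by (simp add: \<theta>_def tetra_def sgn_div_norm)
      then show ?thesis
        unfolding act using True \<theta>[OF lt(1,2)] by (simp add: tetra_op_def tetra_def cis_mult)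
    next
      case False
      then show ?thesis
        unfolding act using supp[OF lt] by (simp add: tetra_op_def)
    qed
  qed
  then show ?thesis
    by (rule luI[rotated 4]) (simp_all only: D_def unitary_diag_cis)
qed

lemma lu_tetra_op:
  assumes "two_unitary 3 T"
  shows "lu 3 T tetra_op"
proof -
  obtain T1 where T1: "lu 3 T T1" "two_unitary 3 T1" "T1 0 0 0 0 = 1"
    using lu_normalize_0000[OF assms] by blast
  obtain T2 where T2: "lu 3 T1 T2" "two_unitary 3 T2" "T2 0 0 0 0 = 1" "T2 0 1 1 1 = 1"
    using lu_normalize_0111[OF T1(2,3)] by blast
  obtain T3 where T3: "lu 3 T2 T3" "two_unitary 3 T3" "T3 0 0 0 0 = 1" "T3 0 1 1 1 = 1" "T3 1 0 1 2 = 1"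
    using lu_normalize_1012[OF T2(2-4)] by blast
  have "lu 3 T3 tetra_op"
    using tetra_support[OF T3(2-5)] by (rule lu_tetra_of_support)
  then show ?thesis
    by (rule lu_trans[OF T1(1) lu_trans[OF T2(1) lu_trans[OF T3(1)]]])
qed

lemma two_unitary_tetra_op: "two_unitary 3 tetra_op"
  unfolding two_unitary_def unitary_op2_def realign_def ptrans_def all_less_3 sum_lessThan_3
  by (simp add: tetra_op_def tetra_def)

subsection \<open>Four-party states\<close>

text \<open>\<open>w2\<close> and \<open>w3\<close> enter transposed, since \<open>v1\<close> and
  \<open>v2\<close> multiply from the right.\<close>

lemma lu_imp_LU_equiv_op2:
  assumes "lu d T T'"
  shows "LU_equiv_op2 d T T'"
proof -
  obtain w0 w1 w2 w3 where w: "unitary_mat d w0" "unitary_mat d w1" "unitary_mat d w2" "unitary_mat d w3"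
    "tensor_eq d T' (act d w0 w1 w2 w3 T)" using assms unfolding lu_def by blast
  have "\<forall>i<d. \<forall>a<d. \<forall>j<d. \<forall>b<d. T' i a j b = (\<Sum>k<d. \<Sum>c<d. \<Sum>l<d. \<Sum>e<d.
      w0 i k * w1 a c * T k c l e * w2 j l * w3 b e)"
    using w(5) by (simp add: tensor_eq_def act_def site_defs sum_distrib_left mult_ac)
  then show ?thesis
    unfolding LU_equiv_op2_def using w(1,2) unitary_transpose[OF w(3)] unitary_transpose[OF w(4)]
    by (intro exI[of _ w0] exI[of _ w1] exI[of _ "\<lambda>l j. w2 j l"] exI[of _ "\<lambda>e b. w3 b e"] conjI)
qed

section \<open>Sums over configurations\<close>

lemma sum_cfgs_insert:
  fixes F :: "(nat \<Rightarrow> nat) \<Rightarrow> 'a :: comm_monoid_add"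
  assumes "r \<notin> S"
  shows "(\<Sum>z\<in>cfgs d (insert r S). F z) = (\<Sum>v<d. \<Sum>z\<in>cfgs d S. F (z(r := v)))"
proof -
  have "cfgs d (insert r S) = (\<lambda>(v, z). z(r := v)) ` ({..<d} \<times> cfgs d S)"
    unfolding cfgs_def by (rule PiE_insert_eq)
  moreover have "inj_on (\<lambda>(v, z). z(r := v)) ({..<d} \<times> cfgs d S)"
    unfolding cfgs_def using assms by (rule inj_combinator)
  ultimately show ?thesis
    by (simp only: sum.reindex sum.cartesian_product' o_def prod.case)
qed

lemma cfgs_empty: "cfgs d {} = {\<lambda>_. undefined}"
  by (simp add: cfgs_def)

text \<open>The party labels are explicit so that one configuration can be written with its parties
  in any order; \<open>undefined\<close> is the value of an extensional function off its
  domain.\<close>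

abbreviation cfg4 :: "nat \<Rightarrow> nat \<Rightarrow> nat \<Rightarrow> nat \<Rightarrow> nat \<Rightarrow> nat \<Rightarrow> nat \<Rightarrow> nat \<Rightarrow> nat \<Rightarrow> nat" where
  "cfg4 p i q a r k s c \<equiv> (\<lambda>_. undefined)(p := i, q := a, r := k, s := c)"

lemma sum_cfgs_4:
  fixes F :: "(nat \<Rightarrow> nat) \<Rightarrow> 'a :: comm_monoid_add"
  shows "(\<Sum>z\<in>cfgs d parties. F z) = (\<Sum>i<d. \<Sum>a<d. \<Sum>j<d. \<Sum>b<d. F (cfg4 0 i 1 a 2 j 3 b))"
proof -
  have "parties = insert 0 (insert 1 (insert 2 (insert 3 {})))"
    by (auto simp: parties_def)
  moreover have "(\<lambda>_. undefined)(3 := b, 2 := j, 1 := a, 0 := i) = cfg4 0 i 1 a 2 j 3 b" for i a j b :: nat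
    by (auto simp: fun_eq_iff)
  moreover have "(\<Sum>z\<in>cfgs d (insert 0 (insert 1 (insert 2 (insert 3 {})))). F z)
      = (\<Sum>i<d. \<Sum>a<d. \<Sum>j<d. \<Sum>b<d. F ((\<lambda>_. undefined)(3 := b, 2 := j, 1 := a, 0 := i)))"
    by (simp add: sum_cfgs_insert cfgs_empty) (simp add: fun_upd_def)
  ultimately show ?thesis
    by (simp only:)
qed

section \<open>AME states and 2-unitary matrices\<close>

text \<open>One half of unitarity. The other half is the same condition on
  \<open>trans_op T\<close>, so 2-unitarity becomes six conditions of one shape, one for each pair
  of parties.\<close>

definition rows_orthonormal :: "nat \<Rightarrow> op2 \<Rightarrow> bool" where
  "rows_orthonormal d T \<longleftrightarrow> (\<forall>i<d. \<forall>a<d. \<forall>j<d. \<forall>b<d.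
     (\<Sum>k<d. \<Sum>c<d. T i a k c * cnj (T j b k c)) = (if i = j \<and> a = b then 1 else 0))"

lemma unitary_op2_iff_rows: "unitary_op2 d T \<longleftrightarrow> rows_orthonormal d T \<and> rows_orthonormal d (trans_op T)"
  unfolding unitary_op2_def rows_orthonormal_def trans_op_def
  by (auto simp: mult.commute[of "cnj _"])

text \<open>The reduced density matrix of \<open>{p, q}\<close> is the Gram matrix of the rows
  indexed by the levels of \<open>p\<close> and \<open>q\<close>; the factor \<open>of_nat d\<close>
  rescales its diagonal value \<open>1 / d ^ 2\<close> to \<open>1\<close>.\<close>

lemma maximally_mixed_pair_iff:
  assumes "distinct [p, q, r, s]" "parties = {p, q, r, s}" "0 < d"
  shows "maximally_mixed_on d \<psi> {p, q} \<longleftrightarrow>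
    rows_orthonormal d (\<lambda>i a k c. of_nat d * \<psi> (cfg4 p i q a r k s c))"
proof -
  let ?x = "\<lambda>i a. (\<lambda>_. undefined)(p := i, q := a) :: nat \<Rightarrow> nat"
  have cfgs: "cfgs d {p, q} = (\<lambda>(i, a). ?x i a) ` ({..<d} \<times> {..<d})"
  proof (rule set_eqI, rule iffI)
    fix x assume "x \<in> cfgs d {p, q}"
    then have *: "x = ?x (x p) (x q)" "x p < d" "x q < d"
      by (auto simp: cfgs_def PiE_iff extensional_def)
    show "x \<in> (\<lambda>(i, a). ?x i a) ` ({..<d} \<times> {..<d})"
      by (rule image_eqI[of _ _ "(x p, x q)"]) (simp only: prod.case, rule *(1), use *(2,3) in simp)
  qed (auto simp: cfgs_def PiE_iff extensional_def)
  have inj: "?x i a = ?x j b \<longleftrightarrow> i = j \<and> a = b" for i a j b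
    using assms(1) by (auto simp: fun_eq_iff)
  have compl: "parties - {p, q} = insert r (insert s {})"
    using assms(1,2) by auto
  have sum2: "(\<Sum>z\<in>cfgs d (insert r (insert s {})). F z) = (\<Sum>k<d. \<Sum>c<d. F ((\<lambda>_. undefined)(s := c, r := k)))"
    for F :: "(nat \<Rightarrow> nat) \<Rightarrow> complex"
    using assms(1) by (simp add: sum_cfgs_insert cfgs_empty) (simp add: fun_upd_def)
  have mix: "(\<lambda>t. if t \<in> {p, q} then ?x i a t else ((\<lambda>_. undefined)(s := c, r := k)) t) = cfg4 p i q a r k s c" for i a k c
    using assms(1) by (auto simp: fun_eq_iff)
  have red: "reduced d \<psi> {p, q} (?x i a) (?x j b)
      = (\<Sum>k<d. \<Sum>c<d. \<psi> (cfg4 p i q a r k s c) * cnj (\<psi> (cfg4 p j q b r k s c)))" for i a j b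
    unfolding reduced_def compl sum2 mix ..
  have scale: "(\<Sum>k<d. \<Sum>c<d. (of_nat d * \<psi> (cfg4 p i q a r k s c)) * cnj (of_nat d * \<psi> (cfg4 p j q b r k s c)))
      = of_nat (d ^ 2) * reduced d \<psi> {p, q} (?x i a) (?x j b)" for i a j b
    unfolding red by (simp add: sum_distrib_left power2_eq_square mult_ac)
  have "card {p, q} = 2" using assms(1) by auto
  then show ?thesis
    unfolding maximally_mixed_on_def rows_orthonormal_def scale cfgs using assms(3)
    by (auto simp: inj field_simps split: if_splits)
qed

text \<open>The inverse of the passage from a matrix to its state; the factor undoes the prefactor
  \<open>1 / d\<close>.\<close>

definition op_of_state :: "nat \<Rightarrow> state4 \<Rightarrow> op2" where
  "op_of_state d \<psi> = (\<lambda>i a j b. of_nat d * \<psi> (cfg4 0 i 1 a 2 j 3 b))"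

lemma two_unitary_op_of_state_iff:
  assumes "0 < d"
  shows "two_unitary d (op_of_state d \<psi>) \<longleftrightarrow> (\<forall>p\<in>parties. \<forall>q\<in>parties. p \<noteq> q \<longrightarrow> maximally_mixed_on d \<psi> {p, q})"
proof -
  let ?U = "op_of_state d \<psi>"
  have parties: "parties = {0, 1, 2, 3}" by (auto simp: parties_def)
  have cfg: "cfg4 0 i 1 a 2 j 3 b = cfg4 2 j 3 b 0 i 1 a" "cfg4 0 i 1 a 2 j 3 b = cfg4 0 i 2 j 1 a 3 b"
    "cfg4 0 i 1 a 2 j 3 b = cfg4 1 a 3 b 0 i 2 j" "cfg4 0 i 1 a 2 j 3 b = cfg4 0 i 3 b 2 j 1 a"
    "cfg4 0 i 1 a 2 j 3 b = cfg4 2 j 1 a 0 i 3 b" for i a j b :: nat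
    by (auto simp: fun_eq_iff)
  have 1: "maximally_mixed_on d \<psi> {0, 1} \<longleftrightarrow> rows_orthonormal d ?U"
    unfolding op_of_state_def
    by (rule maximally_mixed_pair_iff) (use assms in \<open>auto simp: parties\<close>)
  have 2: "maximally_mixed_on d \<psi> {2, 3} \<longleftrightarrow> rows_orthonormal d (trans_op ?U)"
    unfolding op_of_state_def trans_op_def cfg(1)
    by (rule maximally_mixed_pair_iff) (use assms in \<open>auto simp: parties\<close>)
  have 3: "maximally_mixed_on d \<psi> {0, 2} \<longleftrightarrow> rows_orthonormal d (realign ?U)"
    unfolding op_of_state_def realign_def cfg(2)
    by (rule maximally_mixed_pair_iff) (use assms in \<open>auto simp: parties\<close>)
  have 4: "maximally_mixed_on d \<psi> {1, 3} \<longleftrightarrow> rows_orthonormal d (trans_op (realign ?U))"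
    unfolding op_of_state_def realign_def trans_op_def cfg(3)
    by (rule maximally_mixed_pair_iff) (use assms in \<open>auto simp: parties\<close>)
  have 5: "maximally_mixed_on d \<psi> {0, 3} \<longleftrightarrow> rows_orthonormal d (ptrans ?U)"
    unfolding op_of_state_def ptrans_def cfg(4)
    by (rule maximally_mixed_pair_iff) (use assms in \<open>auto simp: parties\<close>)
  have 6: "maximally_mixed_on d \<psi> {2, 1} \<longleftrightarrow> rows_orthonormal d (trans_op (ptrans ?U))"
    unfolding op_of_state_def ptrans_def trans_op_def cfg(5)
    by (rule maximally_mixed_pair_iff) (use assms in \<open>auto simp: parties\<close>)
  have "two_unitary d ?U \<longleftrightarrow> maximally_mixed_on d \<psi> {0, 1} \<and> maximally_mixed_on d \<psi> {2, 3} \<and>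
      maximally_mixed_on d \<psi> {0, 2} \<and> maximally_mixed_on d \<psi> {1, 3} \<and>
      maximally_mixed_on d \<psi> {0, 3} \<and> maximally_mixed_on d \<psi> {2, 1}"
    unfolding two_unitary_def unitary_op2_iff_rows 1 2 3 4 5 6 by blast
  then show ?thesis
    unfolding parties by (auto simp: insert_commute)
qed

text \<open>Tracing out the party \<open>r\<close> adds \<open>d\<close> equal contributions, which
  cancels one factor \<open>d\<close> in the denominator.\<close>

lemma maximally_mixed_on_partial_trace:
  assumes mm: "maximally_mixed_on d \<psi> (insert r S)" and r: "r \<in> parties" "r \<notin> S" and S: "S \<subseteq> parties" and "0 < d"
  shows "maximally_mixed_on d \<psi> S"
  unfolding maximally_mixed_on_def
proof (intro ballI)
  fix x y assume xy: "x \<in> cfgs d S" "y \<in> cfgs d S"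
  have fin: "finite S" using S by (rule finite_subset) (simp add: parties_def)
  have compl: "parties - S = insert r (parties - insert r S)" using r by auto
  have mix: "(\<lambda>p. if p \<in> S then x p else (z(r := v)) p) = (\<lambda>p. if p \<in> insert r S then (x(r := v)) p else z p)" for x z v
    using r by (auto simp: fun_eq_iff)
  have upd: "x(r := v) = y(r := v) \<longleftrightarrow> x = y" for v
  proof
    assume *: "x(r := v) = y(r := v)"
    \<comment> \<open>Both configurations are \<open>undefined\<close> at \<open>r\<close>, which
      lies outside their domain \<open>S\<close>.\<close>
    have "x r = y r" using xy r(2) by (simp add: cfgs_def PiE_iff extensional_def)
    then show "x = y" using * by (metis fun_upd_triv fun_upd_upd)
  qed simp
  have "reduced d \<psi> S x y = (\<Sum>v<d. reduced d \<psi> (insert r S) (x(r := v)) (y(r := v)))"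
    unfolding reduced_def compl by (subst sum_cfgs_insert) (simp, simp only: mix)
  also have "\<dots> = (\<Sum>v<d. if x = y then 1 / of_nat (d ^ card (insert r S)) else 0)"
  proof (rule sum.cong)
    fix v assume "v \<in> {..<d}"
    then have "x(r := v) \<in> cfgs d (insert r S)" "y(r := v) \<in> cfgs d (insert r S)"
      using xy by (auto simp: cfgs_def PiE_iff extensional_def)
    then show "reduced d \<psi> (insert r S) (x(r := v)) (y(r := v)) = (if x = y then 1 / of_nat (d ^ card (insert r S)) else 0)"
      using mm unfolding maximally_mixed_on_def upd[of v, symmetric] by blast
  qed simp
  also have "\<dots> = (if x = y then 1 / of_nat (d ^ card S) else 0)"
    using fin r \<open>0 < d\<close> by simp
  finally show "reduced d \<psi> S x y = (if x = y then 1 / of_nat (d ^ card S) else 0)" .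
qed

text \<open>The pairs suffice: smaller subsets follow by tracing out parties, and normalisation is
  the condition on the empty subset.\<close>

lemma AME4_iff_two_unitary:
  assumes "0 < d"
  shows "AME4 d \<psi> \<longleftrightarrow> two_unitary d (op_of_state d \<psi>)"
proof
  assume "AME4 d \<psi>"
  then show "two_unitary d (op_of_state d \<psi>)"
    unfolding two_unitary_op_of_state_iff[OF assms] AME4_def by (auto simp: card_insert_if)
next
  assume "two_unitary d (op_of_state d \<psi>)"
  then have pair: "maximally_mixed_on d \<psi> {p, q}" if "p \<in> parties" "q \<in> parties" "p \<noteq> q" for p q
    using that unfolding two_unitary_op_of_state_iff[OF assms] by blast
  have single: "maximally_mixed_on d \<psi> {p}" if "p \<in> parties" for p
  proof -
    obtain q where "q \<in> parties" "q \<noteq> p"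
      by (cases "p = 0") (use that[of 0] in \<open>auto simp: parties_def intro: that[of 1]\<close>)
    then show ?thesis
      using pair[of q p] \<open>p \<in> parties\<close> assms by (intro maximally_mixed_on_partial_trace[of d \<psi> q "{p}"]) auto
  qed
  have empty: "maximally_mixed_on d \<psi> {}"
    using single[of 0] assms by (intro maximally_mixed_on_partial_trace[of d \<psi> 0 "{}"]) (auto simp: parties_def)
  have "complex_of_real (\<Sum>f\<in>cfgs d parties. (cmod (\<psi> f))\<^sup>2) = reduced d \<psi> {} (\<lambda>_. undefined) (\<lambda>_. undefined)"
    by (simp add: reduced_def complex_norm_square[symmetric])
  also have "\<dots> = 1"
    using empty by (simp add: maximally_mixed_on_def cfgs_empty)
  finally have "pure_state4 d \<psi>"
    unfolding pure_state4_def of_real_eq_1_iff .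
  moreover have "maximally_mixed_on d \<psi> S" if S: "S \<subseteq> parties" "card S \<le> 2" for S
  proof -
    have "finite S" using S(1) by (rule finite_subset) (simp add: parties_def)
    consider "card S = 0" | "card S = 1" | "card S = 2" using S(2) by linarith
    then show ?thesis
    proof cases
      case 1
      then show ?thesis using empty \<open>finite S\<close> by simp
    next
      case 2
      then obtain p where "S = {p}" by (rule card_1_singletonE)
      then show ?thesis using single S(1) by simp
    next
      case 3
      then show ?thesis using pair S(1) by (auto simp: card_2_iff)
    qed
  qed
  ultimately show "AME4 d \<psi>" by (simp add: AME4_def)
qed

lemma lu_imp_LU_equiv_state4:
  assumes "lu d (op_of_state d \<psi>1) (op_of_state d \<psi>2)" "0 < d"
  shows "LU_equiv_state4 d \<psi>1 \<psi>2"
proof -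
  obtain w0 w1 w2 w3 where w: "unitary_mat d w0" "unitary_mat d w1" "unitary_mat d w2" "unitary_mat d w3"
    "tensor_eq d (op_of_state d \<psi>2) (act d w0 w1 w2 w3 (op_of_state d \<psi>1))" using assms unfolding lu_def by blast
  define w where "w = (\<lambda>p::nat. if p = 0 then w0 else if p = 1 then w1 else if p = 2 then w2 else w3)"
  have parties: "parties = {0, 1, 2, 3}" by (auto simp: parties_def)
  have "\<psi>2 f = (\<Sum>g\<in>cfgs d parties. (\<Prod>p\<in>parties. w p (f p) (g p)) * \<psi>1 g)" if "f \<in> cfgs d parties" for f
  proof -
    have f: "f = cfg4 0 (f 0) 1 (f 1) 2 (f 2) 3 (f 3)" "f 0 < d" "f 1 < d" "f 2 < d" "f 3 < d"
      using that by (auto simp: cfgs_def PiE_iff extensional_def fun_eq_iff parties)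
    have "of_nat d * \<psi>2 f = op_of_state d \<psi>2 (f 0) (f 1) (f 2) (f 3)"
      unfolding op_of_state_def f(1)[symmetric] ..
    also have "\<dots> = act d w0 w1 w2 w3 (op_of_state d \<psi>1) (f 0) (f 1) (f 2) (f 3)"
      using w(5) f(2-5) by (simp add: tensor_eq_def)
    also have "\<dots> = of_nat d * (\<Sum>g\<in>cfgs d parties. (\<Prod>p\<in>parties. w p (f p) (g p)) * \<psi>1 g)"
      unfolding sum_cfgs_4
      by (simp add: act_def site_defs op_of_state_def parties w_def sum_distrib_left mult_ac)
    finally show ?thesis using assms(2) by simp
  qed
  moreover have "\<forall>p\<in>parties. unitary_mat d (w p)" using w(1-4) by (simp add: w_def)
  ultimately show ?thesis unfolding LU_equiv_state4_def by blast
qed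

theorem theorem1:
  shows "(\<exists>U. two_unitary 3 U) \<and>
         (\<forall>U U'. two_unitary 3 U \<and> two_unitary 3 U' \<longrightarrow> LU_equiv_op2 3 U U') \<and>
         (\<exists>\<psi>. AME4 3 \<psi>) \<and>
         (\<forall>\<psi>1 \<psi>2. AME4 3 \<psi>1 \<and> AME4 3 \<psi>2 \<longrightarrow> LU_equiv_state4 3 \<psi>1 \<psi>2)"
proof (intro conjI allI impI; (elim conjE)?)
  have lu: "lu 3 U U'" if "two_unitary 3 U" "two_unitary 3 U'" for U U'
    using lu_tetra_op[OF that(1)] lu_sym[OF lu_tetra_op[OF that(2)]] by (rule lu_trans)
  show "\<exists>U. two_unitary 3 U"
    using two_unitary_tetra_op by blast
  \<comment> \<open>The equal superposition of the nine code words of the tetracode;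
    \<open>1 / 3\<close> is the prefactor \<open>1 / d\<close>.\<close>
  have "op_of_state 3 (\<lambda>f. tetra_op (f 0) (f 1) (f 2) (f 3) / 3) = tetra_op"
    by (simp add: op_of_state_def)
  then have "AME4 3 (\<lambda>f. tetra_op (f 0) (f 1) (f 2) (f 3) / 3)"
    using two_unitary_tetra_op by (simp add: AME4_iff_two_unitary)
  then show "\<exists>\<psi>. AME4 3 \<psi>" by blast
  fix U U' assume "two_unitary 3 U" "two_unitary 3 U'"
  then show "LU_equiv_op2 3 U U'"
    by (intro lu_imp_LU_equiv_op2 lu)
next
  fix \<psi>1 \<psi>2 assume "AME4 3 \<psi>1" "AME4 3 \<psi>2"
  then have "two_unitary 3 (op_of_state 3 \<psi>1)" "two_unitary 3 (op_of_state 3 \<psi>2)"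
    by (simp_all add: AME4_iff_two_unitary)
  then have "lu 3 (op_of_state 3 \<psi>1) (op_of_state 3 \<psi>2)"
    using lu_tetra_op lu_sym lu_trans by blast
  then show "LU_equiv_state4 3 \<psi>1 \<psi>2"
    by (rule lu_imp_LU_equiv_state4) simp
qed

end
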